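(* Let $\kappa$ be an uncountable cardinal with $\kappa=\kappa^{<\kappa}$ and assume the Generalized Martin's Axiom $\mathrm{GMA}(\kappa)$. Then the ideal of strong measure zero subsets of ${}^{\kappa}2$ is $2^{\kappa}$-additive; that is, whenever $\gamma<2^{\kappa}$ and $\langle A_\xi:\xi<\gamma\rangle$ is a sequence of strong measure zero subsets of ${}^{\kappa}2$, the union $\bigcup_{\xi<\gamma}A_\xi$ has strong measure zero.
   Context: For an ordinal $\xi$, ${}^{\xi}2$ is the set of functions $\xi\to\{0,1\}$. For $\xi<\kappa$ and $f\in{}^{\xi}2$ put $[f]=\{\eta\in{}^{\kappa}2: f\subseteq\eta\}$. A set $A\subseteq{}^{\kappa}2$ has strong measure zero if for every $X\subseteq\kappa$ with $|X|=\kappa$ there are $f_\xi\in{}^{\xi}2$ ($\xi\in X$) with $A\subseteq\bigcup_{\xi\in X}[f_\xi]$. $\mathrm{GMA}(\kappa)$ (Shelah's generalized Martin's axiom, for $\kappa=\kappa^{<\kappa}$) is the following statement. Let $P$ be a partial order such that (1) any two compatible elements of $P$ have a greatest lower bound; (2) every decreasing sequence in $P$ of length $<\kappa$ has a greatest lower bound; (3) for every sequence $\langle p_\alpha:\alpha<\kappa^+\rangle$ of elements of $P$ there are a closed unbounded set $C\subseteq\kappa^+$ and a regressive function $f:\kappa^+\to\kappa^+$ (that is, $f(\alpha)<\alpha$ for all $0<\alpha<\kappa^+$) such that whenever $\alpha,\beta\in C$ have cofinality $\kappa$ and $f(\alpha)=f(\beta)$, then $p_\alpha$ and $p_\beta$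 are compatible. Then for every family $\mathcal{D}$ of fewer than $2^{\kappa}$ dense subsets of $P$ there is a filter $G\subseteq P$ meeting every member of $\mathcal{D}$. *)

theory Defs
  imports Main
begin

unbundle cardinal_syntax

text \<open>
  A cardinal is given by a relation k with \<open>Card_order k\<close>, i.e. by an initial well-order. The
  ordinals below it are the elements of \<open>Field k\<close>, and an ordinal \<open>\<xi> \<in> Field k\<close>, regarded as the
  set of its predecessors, is \<open>underS k \<xi>\<close>. The functions from A to B are \<open>Func A B\<close>, with
  the value \<open>undefined\<close> outside A; the set of all functions from \<open>\<kappa>\<close> to 2 has cardinality
  \<open>ctwo ^c k\<close>.
\<close>

text \<open>
  \<open>\<kappa>\<close> equals the cardinality of the set of all sequences in \<open>\<kappa>\<close> of length less than \<open>\<kappa>\<close>. The disjoint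
  sum over the lengths is used because \<open>Func A B\<close> and \<open>Func A' B\<close> may overlap for \<open>A \<noteq> A'\<close> when
  \<open>undefined \<in> B\<close>.
\<close>

definition eq_lt_power :: "'k rel \<Rightarrow> bool" where
  "eq_lt_power k \<longleftrightarrow> k =o |SIGMA \<xi> : Field k. Func (underS k \<xi>) (Field k)|"


definition seqs2 :: "'k rel \<Rightarrow> 'k \<Rightarrow> ('k \<Rightarrow> bool) set" where
  "seqs2 k \<xi> = Func (underS k \<xi>) (UNIV :: bool set)"

definition space2 :: "'k rel \<Rightarrow> ('k \<Rightarrow> bool) set" where
  "space2 k = Func (Field k) (UNIV :: bool set)"

text \<open>The basic open set of all \<open>\<eta>\<close> extending f. The length \<open>\<xi>\<close> of f is an argument since it
  cannot be read off from f.\<close>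

definition cone :: "'k rel \<Rightarrow> 'k \<Rightarrow> ('k \<Rightarrow> bool) \<Rightarrow> ('k \<Rightarrow> bool) set" where
  "cone k \<xi> f = {\<eta> \<in> space2 k. \<forall>\<alpha> \<in> underS k \<xi>. \<eta> \<alpha> = f \<alpha>}"

definition strong_measure_zero :: "'k rel \<Rightarrow> ('k \<Rightarrow> bool) set \<Rightarrow> bool" where
  "strong_measure_zero k A \<longleftrightarrow>
     A \<subseteq> space2 k \<and>
     (\<forall>X. X \<subseteq> Field k \<and> |X| =o k \<longrightarrow>
        (\<exists>f. (\<forall>\<xi> \<in> X. f \<xi> \<in> seqs2 k \<xi>) \<and> A \<subseteq> (\<Union>\<xi> \<in> X. cone k \<xi> (f \<xi>))))"


text \<open>In the following, P is the carrier of a partial order and \<open>(p, q) \<in> R\<close> means \<open>p \<le> q\<close>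
  (p is the stronger condition).\<close>

definition compatible :: "'p set \<Rightarrow> 'p rel \<Rightarrow> 'p \<Rightarrow> 'p \<Rightarrow> bool" where
  "compatible P R p q \<longleftrightarrow> (\<exists>s \<in> P. (s, p) \<in> R \<and> (s, q) \<in> R)"

definition is_glb :: "'p set \<Rightarrow> 'p rel \<Rightarrow> 'p set \<Rightarrow> 'p \<Rightarrow> bool" where
  "is_glb P R S g \<longleftrightarrow>
     g \<in> P \<and> (\<forall>s \<in> S. (g, s) \<in> R) \<and> (\<forall>h \<in> P. (\<forall>s \<in> S. (h, s) \<in> R) \<longrightarrow> (h, g) \<in> R)"

definition dense_in :: "'p set \<Rightarrow> 'p rel \<Rightarrow> 'p set \<Rightarrow> bool" where
  "dense_in P R D \<longleftrightarrow> D \<subseteq> P \<and> (\<forall>p \<in> P. \<exists>d \<in> D. (d, p) \<in> R)"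

definition filter_in :: "'p set \<Rightarrow> 'p rel \<Rightarrow> 'p set \<Rightarrow> bool" where
  "filter_in P R G \<longleftrightarrow>
     G \<subseteq> P \<and> G \<noteq> {} \<and>
     (\<forall>p \<in> G. \<forall>q \<in> P. (p, q) \<in> R \<longrightarrow> q \<in> G) \<and>
     (\<forall>p \<in> G. \<forall>q \<in> G. \<exists>s \<in> G. (s, p) \<in> R \<and> (s, q) \<in> R)"


definition cofinal_below :: "'o rel \<Rightarrow> 'o \<Rightarrow> 'o set \<Rightarrow> bool" where
  "cofinal_below s \<alpha> A \<longleftrightarrow> A \<subseteq> underS s \<alpha> \<and> (\<forall>\<beta> \<in> underS s \<alpha>. \<exists>\<gamma> \<in> A. (\<beta>, \<gamma>) \<in> s)"

text \<open>The cofinality of \<open>\<alpha>\<close>, the least cardinality of a cofinal subset of \<open>\<alpha>\<close>, is k.\<close>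

definition has_cofinality :: "'o rel \<Rightarrow> 'o \<Rightarrow> 'k rel \<Rightarrow> bool" where
  "has_cofinality s \<alpha> k \<longleftrightarrow>
     (\<exists>A. cofinal_below s \<alpha> A \<and> |A| =o k) \<and> (\<forall>A. cofinal_below s \<alpha> A \<longrightarrow> k \<le>o |A| )"

text \<open>In the closure clause, the element \<open>\<gamma>\<close> is strictly between \<open>\<beta>\<close> and \<open>\<alpha>\<close>, so the clause
  only concerns limit ordinals \<open>\<alpha>\<close>. The library's \<open>cofinal C s\<close> says that C is unbounded in s.\<close>

definition club :: "'o rel \<Rightarrow> 'o set \<Rightarrow> bool" where
  "club s C \<longleftrightarrow>
     C \<subseteq> Field s \<and> cofinal C s \<and>
     (\<forall>\<alpha> \<in> Field s. underS s \<alpha> \<noteq> {} \<and>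
        (\<forall>\<beta> \<in> underS s \<alpha>. \<exists>\<gamma> \<in> C \<inter> underS s \<alpha>. \<beta> \<in> underS s \<gamma>) \<longrightarrow> \<alpha> \<in> C)"

definition regressive :: "'o rel \<Rightarrow> ('o \<Rightarrow> 'o) \<Rightarrow> bool" where
  "regressive s f \<longleftrightarrow>
     (\<forall>\<alpha> \<in> Field s. f \<alpha> \<in> Field s) \<and>
     (\<forall>\<alpha> \<in> Field s. underS s \<alpha> \<noteq> {} \<longrightarrow> f \<alpha> \<in> underS s \<alpha>)"


definition binary_glbs :: "'p set \<Rightarrow> 'p rel \<Rightarrow> bool" where
  "binary_glbs P R \<longleftrightarrow>
     (\<forall>p \<in> P. \<forall>q \<in> P. compatible P R p q \<longrightarrow> (\<exists>g. is_glb P R {p, q} g))"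

text \<open>The empty sequence is included: P has a largest element.\<close>

definition short_sequence_glbs :: "'k rel \<Rightarrow> 'p set \<Rightarrow> 'p rel \<Rightarrow> bool" where
  "short_sequence_glbs k P R \<longleftrightarrow>
     (\<forall>\<xi> \<in> Field k. \<forall>p :: 'k \<Rightarrow> 'p.
        (\<forall>\<alpha> \<in> underS k \<xi>. p \<alpha> \<in> P) \<and>
        (\<forall>\<alpha> \<in> underS k \<xi>. \<forall>\<beta> \<in> underS k \<xi>. (\<alpha>, \<beta>) \<in> k \<longrightarrow> (p \<beta>, p \<alpha>) \<in> R) \<longrightarrow>
        (\<exists>g. is_glb P R (p ` underS k \<xi>) g))"

definition stationary_chain_condition :: "'k rel \<Rightarrow> 'p set \<Rightarrow> 'p rel \<Rightarrow> bool" where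
  "stationary_chain_condition k P R \<longleftrightarrow>
     (\<forall>p :: 'k set \<Rightarrow> 'p. (\<forall>\<alpha> \<in> Field (cardSuc k). p \<alpha> \<in> P) \<longrightarrow>
        (\<exists>C f. club (cardSuc k) C \<and> regressive (cardSuc k) f \<and>
           (\<forall>\<alpha> \<in> C. \<forall>\<beta> \<in> C.
              has_cofinality (cardSuc k) \<alpha> k \<and> has_cofinality (cardSuc k) \<beta> k \<and> f \<alpha> = f \<beta> \<longrightarrow>
              compatible P R (p \<alpha>) (p \<beta>))))"

text \<open>
  Generalized Martin's axiom for k. Since HOL cannot quantify over types inside a formula, the
  partial orders range over all those whose elements are drawn from a type \<open>'p\<close>, which serves as the
  universe of conditions. The axiom only has its full meaning if this type has at least \<open>2^\<kappa>\<close>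
  elements; for \<open>\<kappa> = \<kappa>^{<\<kappa>}\<close> larger types add nothing, as a larger partial order can be cut down to a
  suborder of size \<open>2^\<kappa>\<close> closed under the greatest lower bounds required and under witnesses
  for the density of the given sets.
\<close>

definition GMA :: "'p itself \<Rightarrow> 'k rel \<Rightarrow> bool" where
  "GMA _ k \<longleftrightarrow>
     (\<forall>(P :: 'p set) (R :: 'p rel).
        partial_order_on P R \<and>
        binary_glbs P R \<and> short_sequence_glbs k P R \<and> stationary_chain_condition k P R \<longrightarrow>
        (\<forall>\<D> :: 'p set set. (\<forall>D \<in> \<D>. dense_in P R D) \<and> |\<D>| <o ctwo ^c k \<longrightarrow>
           (\<exists>G. filter_in P R G \<and> (\<forall>D \<in> \<D>. G \<inter> D \<noteq> {}))))"

end

theory Submission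
  imports Defs
begin

text \<open>
  Let \<open>I\<close> be the index set of the union; its members are themselves branches \<open>i\<close> of the tree of all
  functions \<open>\<beta> \<rightarrow> 2\<close> with \<open>\<beta> < \<kappa>\<close>. Since \<open>2^{<\<kappa>} = \<kappa>\<close>, every node of the tree can be given two
  private slots in the prescribed set \<open>X\<close> of lengths. For \<open>i \<in> I\<close> and \<open>c < \<kappa>\<close>, the set \<open>A i\<close> is
  covered by a family of cones, one for every node \<open>i \<restriction> \<beta>\<close> with \<open>\<beta> \<ge> c\<close>, each of them
  narrow enough for both slots of its node. The forcing chooses for each \<open>i\<close> some \<open>c\<close>
  such that no node receives more than two different cones, so that the two slots suffice.

  A condition consists of fewer than \<open>\<kappa>\<close> pairs \<open>(i, c)\<close>, and the restriction to two cones per node is of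
  finite character, so that greatest lower bounds are unions. If \<open>\<rho>\<close> is so large that the branches
  of a condition are pairwise different below \<open>\<rho>\<close>, then two conditions with the same trace below \<open>\<rho>\<close>
  are compatible: below \<open>\<rho>\<close> they ask for the same cones, and at any node from
  \<open>\<rho>\<close> on each of them asks for at most one. There are only \<open>\<kappa>\<close> traces.
\<close>

subsection \<open>Cardinals with \<open>\<kappa> = \<kappa>^{<\<kappa>}\<close>\<close>

locale power_card =
  fixes k :: "'k rel"
  assumes card: "Card_order k"
    and infinite: "\<not> finite (Field k)"
    and power: "eq_lt_power k"
begin

section \<open>The order of \<open>k\<close>, bounded sets and regularity\<close>

lemma Cinf: "Cinfinite k"
  using card infinite by (simp add: cinfinite_def)

lemma wo: "wo_rel k"
  using card by (simp add: card_order_on_def wo_rel_def)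

lemma underS_le_trans: "\<lbrakk>a \<in> underS k b; (b, c) \<in> k\<rbrakk> \<Longrightarrow> a \<in> underS k c"
  using wo_rel.TRANS[OF wo] wo_rel.ANTISYM[OF wo]
  unfolding underS_def trans_def antisym_def by blast

lemma underS_or_le: "\<lbrakk>a \<in> Field k; b \<in> Field k\<rbrakk> \<Longrightarrow> a \<in> underS k b \<or> (b, a) \<in> k"
  using wo_rel.TOTALS[OF wo] unfolding underS_def by blast

lemma not_underS_and_le: "\<lbrakk>a \<in> underS k b; (b, a) \<in> k\<rbrakk> \<Longrightarrow> False"
  using wo_rel.ANTISYM[OF wo] unfolding underS_def antisym_def by blast

lemma underS_in_Field: "a \<in> underS k b \<Longrightarrow> a \<in> Field k \<and> b \<in> Field k"
  unfolding underS_def Field_def by blast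

lemma ex_above: "a \<in> Field k \<Longrightarrow> \<exists>b \<in> Field k. a \<in> underS k b"
  using infinite_Card_order_limit[OF card infinite] unfolding underS_def by blast

text \<open>A smaller cardinal is isomorphic to a proper initial segment of \<open>k\<close>. This
  turns small sets into short sequences, which can then be coded.\<close>

lemma small_bij:
  assumes "|A| <o k"
  shows "\<exists>\<xi> \<in> Field k. \<exists>h. bij_betw h (underS k \<xi>) A"
proof -
  have "Well_order k" using wo by (simp add: wo_rel_def)
  then obtain \<xi> where \<xi>: "\<xi> \<in> Field k" and iso: "|A| =o Restr k (underS k \<xi>)"
    using assms ordLess_iff_ordIso_Restr[of k "|A|"] card_of_Well_order by blast
  have "Field (Restr k (underS k \<xi>)) = underS k \<xi>"
    using \<open>Well_order k\<close> wo_rel.underS_ofilter[OF wo] by (simp add: Field_Restr_ofilter)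
  then have "|A| =o |underS k \<xi>|"
    using card_of_cong[OF iso] by (simp add: Field_card_of)
  then have "\<exists>h. bij_betw h (underS k \<xi>) A"
    using card_of_ordIso ordIso_symmetric by blast
  with \<xi> show ?thesis by blast
qed

text \<open>This is the form of \<open>eq_lt_power\<close> used for regularity and for the colours
  of conditions: elements of \<open>Field k\<close> serve as codes of all short sequences.\<close>

lemma ex_coding:
  "\<exists>\<nu>. bij_betw \<nu> (SIGMA \<xi> : Field k. Func (underS k \<xi>) (Field k)) (Field k)"
proof -
  have "|Field k| =o |SIGMA \<xi> : Field k. Func (underS k \<xi>) (Field k)|"
    using power card_of_Field_ordIso[OF card] ordIso_transitive
    unfolding eq_lt_power_def by blast
  then show ?thesis using card_of_ordIso ordIso_symmetric by blast
qed

text \<open>Koenig's argument: from a short cofinal set one diagonalizes against all short sequences.\<close>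

lemma small_bounded:
  assumes K: "K \<subseteq> Field k" "|K| <o k"
  shows "\<exists>\<rho> \<in> Field k. K \<subseteq> underS k \<rho>"
proof (rule ccontr)
  assume unb: "\<not> ?thesis"
  obtain \<xi> h where \<xi>: "\<xi> \<in> Field k" and h: "bij_betw h (underS k \<xi>) K"
    using small_bij[OF K(2)] by blast
  obtain \<nu> where \<nu>: "bij_betw \<nu> (SIGMA \<xi> : Field k. Func (underS k \<xi>) (Field k)) (Field k)"
    using ex_coding by blast
  define \<phi> where "\<phi> = inv_into (SIGMA \<xi> : Field k. Func (underS k \<xi>) (Field k)) \<nu>"
  \<comment> \<open>\<open>V \<beta>\<close> collects the entries at \<open>\<beta>\<close> of all
    sequences with codes below \<open>h \<beta>\<close>. There are fewer than \<open>k\<close> of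
    them, so \<open>g\<close> can avoid \<open>V \<beta>\<close> at every
    \<open>\<beta>\<close>.\<close>
  define V where "V \<beta> = (\<lambda>\<alpha>. snd (\<phi> \<alpha>) \<beta>) ` underS k (h \<beta>)" for \<beta>
  have "\<exists>y. y \<in> Field k \<and> y \<notin> V \<beta>" if "\<beta> \<in> underS k \<xi>" for \<beta>
  proof (rule ccontr)
    assume "\<not> ?thesis"
    then have "|Field k| \<le>o |underS k (h \<beta>)|"
      unfolding V_def by (intro surj_imp_ordLeq) blast
    moreover have "h \<beta> \<in> Field k" using h that K unfolding bij_betw_def by blast
    ultimately have "|Field k| <o k"
      using card_of_underS[OF card] ordLeq_ordLess_trans by blast
    then show False
      using card_of_Field_ordIso[OF card] not_ordLess_ordIso by blast
  qed
  then obtain y where y: "\<And>\<beta>. \<beta> \<in> underS k \<xi> \<Longrightarrow> y \<beta> \<in> Field k \<and> y \<beta> \<notin> V \<beta>"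
    by metis
  define g where "g \<beta> = (if \<beta> \<in> underS k \<xi> then y \<beta> else undefined)" for \<beta>
  have g: "(\<xi>, g) \<in> (SIGMA \<xi> : Field k. Func (underS k \<xi>) (Field k))"
    using \<xi> y unfolding g_def Func_def by auto
  define \<alpha> where "\<alpha> = \<nu> (\<xi>, g)"
  have \<alpha>: "\<alpha> \<in> Field k" "\<phi> \<alpha> = (\<xi>, g)"
    using g \<nu> unfolding \<alpha>_def \<phi>_def bij_betw_def by auto
  \<comment> \<open>As \<open>K\<close> is unbounded, the code \<open>\<alpha>\<close> of
    \<open>g\<close> lies below some \<open>b = h \<beta>\<close>; then \<open>V \<beta>\<close>
    contains the entry of \<open>g\<close> itself at \<open>\<beta>\<close>.\<close>
  obtain \<alpha>' where \<alpha>': "\<alpha>' \<in> Field k" "\<alpha> \<in> underS k \<alpha>'" using ex_above \<alpha> by blast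
  obtain b where b: "b \<in> K" "b \<notin> underS k \<alpha>'" using unb \<alpha>' by blast
  then have "\<alpha> \<in> underS k b"
    using underS_or_le[of b \<alpha>'] \<alpha>' K underS_le_trans by blast
  moreover obtain \<beta> where \<beta>: "\<beta> \<in> underS k \<xi>" "h \<beta> = b"
    using h b unfolding bij_betw_def by blast
  ultimately have "g \<beta> \<in> V \<beta>" using \<alpha> unfolding V_def by force
  with y[OF \<beta>(1)] \<beta>(1) show False unfolding g_def by simp
qed

text \<open>By \<open>small_bounded\<close> an unbounded set cannot be small. Regularity is what
  keeps unions of fewer than \<open>k\<close> small sets small.\<close>

lemma regular: "regularCard k"
  unfolding regularCard_def
proof (intro allI impI, elim conjE)
  fix K assume K: "K \<subseteq> Field k" "cofinal K k"
  have le: "|K| \<le>o k"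
    using card_of_mono1[OF K(1)] card_of_Field_ordIso[OF card] ordLeq_ordIso_trans by blast
  have "\<not> |K| <o k"
  proof
    assume "|K| <o k"
    then obtain \<rho> where "\<rho> \<in> Field k" "K \<subseteq> underS k \<rho>" using small_bounded K by blast
    then show False
      using K(2) not_underS_and_le unfolding cofinal_def by blast
  qed
  with le show "|K| =o k" by (simp add: ordLeq_iff_ordLess_or_ordIso)
qed

section \<open>Closure properties of small sets\<close>

lemma small_UN: "\<lbrakk>|I| <o k; \<And>i. i \<in> I \<Longrightarrow> |B i| <o k\<rbrakk> \<Longrightarrow> |\<Union>i \<in> I. B i| <o k"
  using card_of_UNION_ordLess_infinite_Field_regularCard[OF regular Cinf] by blast

lemma small_subset: "\<lbrakk>B \<subseteq> A; |A| <o k\<rbrakk> \<Longrightarrow> |B| <o k"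
  using card_of_mono1 ordLeq_ordLess_trans by blast

lemma small_Un: "\<lbrakk>|A| <o k; |B| <o k\<rbrakk> \<Longrightarrow> |A \<union> B| <o k"
  using Un_Cinfinite_bound_strict Cinf by blast

lemma small_insert: "|A| <o k \<Longrightarrow> |insert a A| <o k"
proof -
  assume "|A| <o k"
  moreover have "|{a}| <o k"
    using infinite card card_of_well_order_on
    by (intro finite_ordLess_infinite) (auto simp: card_order_on_def Field_card_of)
  ultimately show ?thesis using small_Un[of "{a}" A] by simp
qed

subsection \<open>The axiom for families of small sets\<close>

text \<open>If \<open>k\<close> colours suffice to make equally coloured elements compatible, the
  colours can be embedded below one ordinal \<open>\<alpha>0\<close> of the successor cardinal. On
  the club of all ordinals from \<open>\<alpha>0\<close> on, the colour is then itself a regressive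
  function.\<close>

lemma stationary_chain_condition_colouring:
  fixes P :: "'p set"
  assumes col: "\<And>p. p \<in> P \<Longrightarrow> col p \<in> Field k"
    and comp: "\<And>p q. \<lbrakk>p \<in> P; q \<in> P; col p = col q\<rbrakk> \<Longrightarrow> compatible P R p q"
  shows "stationary_chain_condition k P R"
  unfolding stationary_chain_condition_def
proof (intro allI impI)
  let ?s = "cardSuc k"
  fix p :: "'k set \<Rightarrow> 'p"
  assume p: "\<forall>\<alpha> \<in> Field ?s. p \<alpha> \<in> P"
  have s: "Card_order ?s" "\<not> finite (Field ?s)"
    using card infinite by (auto simp: cardSuc_Card_order cardSuc_finite)
  have ws: "wo_rel ?s" using s(1) by (simp add: card_order_on_def wo_rel_def)
  have "|Field k| <o ?s"
    using card_of_Field_ordIso[OF card] cardSuc_greater[OF card] ordIso_ordLess_trans by blast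
  then obtain \<alpha>0 where \<alpha>0: "\<alpha>0 \<in> Field ?s" and iso: "|Field k| =o Restr ?s (underS ?s \<alpha>0)"
    using ordLess_iff_ordIso_Restr[of ?s "|Field k|"] card_of_Well_order ws wo_rel_def by metis
  have "Field (Restr ?s (underS ?s \<alpha>0)) = underS ?s \<alpha>0"
    using ws wo_rel.underS_ofilter[OF ws] by (simp add: Field_Restr_ofilter wo_rel_def)
  then have "|Field k| =o |underS ?s \<alpha>0|"
    using card_of_cong[OF iso] by (simp add: Field_card_of)
  then obtain j where j: "bij_betw j (Field k) (underS ?s \<alpha>0)"
    using card_of_ordIso by metis
  define C where "C = {\<alpha> \<in> Field ?s. (\<alpha>0, \<alpha>) \<in> ?s}"
  \<comment> \<open>Off \<open>C\<close> only regressiveness matters. The least ordinal has nothing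
    below it, and there the value \<open>\<alpha>\<close> keeps \<open>f\<close> inside the
    field.\<close>
  define f where "f \<alpha> = (if \<alpha> \<in> C then j (col (p \<alpha>))
    else if underS ?s \<alpha> = {} then \<alpha> else (SOME \<beta>. \<beta> \<in> underS ?s \<alpha>))" for \<alpha>
  have trans: "\<And>a b c. \<lbrakk>(a, b) \<in> ?s; (b, c) \<in> ?s\<rbrakk> \<Longrightarrow> (a, c) \<in> ?s"
    using wo_rel.TRANS[OF ws] unfolding trans_def by blast
  have anti: "\<And>a b. \<lbrakk>(a, b) \<in> ?s; (b, a) \<in> ?s\<rbrakk> \<Longrightarrow> a = b"
    using wo_rel.ANTISYM[OF ws] unfolding antisym_def by blast
  have club: "club ?s C"
    unfolding club_def
  proof (intro conjI ballI impI)
    show "C \<subseteq> Field ?s" unfolding C_def by blast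
    show "cofinal C ?s"
      unfolding cofinal_def
    proof
      fix a assume a: "a \<in> Field ?s"
      obtain b where b: "b \<in> Field ?s" "(\<alpha>0, b) \<in> ?s" "(a, b) \<in> ?s"
        using wo_rel.TOTALS[OF ws] a \<alpha>0 by blast
      \<comment> \<open>\<open>cofinal\<close> asks for a strictly larger element, hence the move
        from the maximum \<open>b\<close> to a larger \<open>b'\<close>.\<close>
      obtain b' where b': "b' \<in> Field ?s" "b \<noteq> b'" "(b, b') \<in> ?s"
        using infinite_Card_order_limit[OF s b(1)] by blast
      then have "b' \<in> C" "(a, b') \<in> ?s" "a \<noteq> b'"
        using b trans anti unfolding C_def by blast+
      then show "\<exists>b \<in> C. a \<noteq> b \<and> (a, b) \<in> ?s" by blast
    qed
    fix \<alpha> assume \<alpha>: "\<alpha> \<in> Field ?s" and lim: "underS ?s \<alpha> \<noteq> {} \<and>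
      (\<forall>\<beta> \<in> underS ?s \<alpha>. \<exists>\<gamma> \<in> C \<inter> underS ?s \<alpha>. \<beta> \<in> underS ?s \<gamma>)"
    then obtain \<gamma> where "\<gamma> \<in> C" "\<gamma> \<in> underS ?s \<alpha>" by blast
    then have "(\<alpha>0, \<gamma>) \<in> ?s" "(\<gamma>, \<alpha>) \<in> ?s" unfolding C_def underS_def by simp_all
    then show "\<alpha> \<in> C" using trans \<alpha> unfolding C_def by simp
  qed
  have fC: "f \<alpha> \<in> underS ?s \<alpha>0" if "\<alpha> \<in> C" for \<alpha>
    using that j col p unfolding f_def bij_betw_def C_def by auto
  have "regressive ?s f"
    unfolding regressive_def
  proof (intro conjI ballI impI)
    fix \<alpha> assume \<alpha>: "\<alpha> \<in> Field ?s"
    have R: "f \<alpha> \<in> underS ?s \<alpha>" if "underS ?s \<alpha> \<noteq> {}"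
    proof (cases "\<alpha> \<in> C")
      case True
      then have "f \<alpha> \<noteq> \<alpha>0" "(f \<alpha>, \<alpha>0) \<in> ?s" "(\<alpha>0, \<alpha>) \<in> ?s"
        using fC[OF True] unfolding C_def underS_def by simp_all
      moreover from this have "(f \<alpha>, \<alpha>) \<in> ?s" by (blast intro: trans)
      moreover from calculation have "f \<alpha> \<noteq> \<alpha>" using anti by metis
      ultimately show ?thesis unfolding underS_def by simp
    next
      case False
      then show ?thesis using that unfolding f_def by (auto intro: someI)
    qed
    then show "underS ?s \<alpha> \<noteq> {} \<Longrightarrow> f \<alpha> \<in> underS ?s \<alpha>" .
    show "f \<alpha> \<in> Field ?s"
    proof (cases "underS ?s \<alpha> = {}")
      case True
      show ?thesis
      proof (cases "\<alpha> \<in> C")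
        case True
        then show ?thesis using fC by (blast dest: underS_Field)
      next
        case False
        then show ?thesis using True \<alpha> unfolding f_def by simp
      qed
    next
      case False
      then show ?thesis using R by (blast dest: underS_Field)
    qed
  qed
  moreover have "compatible P R (p \<alpha>) (p \<beta>)" if "\<alpha> \<in> C" "\<beta> \<in> C" "f \<alpha> = f \<beta>" for \<alpha> \<beta>
  proof -
    have "p \<alpha> \<in> P" "p \<beta> \<in> P" using that p unfolding C_def by auto
    moreover from this have "col (p \<alpha>) = col (p \<beta>)"
      using that j col unfolding f_def bij_betw_def inj_on_def by auto
    ultimately show ?thesis using comp by blast
  qed
  ultimately show "\<exists>C f. club ?s C \<and> regressive ?s f \<and>
      (\<forall>\<alpha> \<in> C. \<forall>\<beta> \<in> C. has_cofinality ?s \<alpha> k \<and> has_cofinality ?s \<beta> k \<and> f \<alpha> = f \<beta> \<longrightarrow>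
        compatible P R (p \<alpha>) (p \<beta>))"
    using club by blast
qed

text \<open>The axiom for sets ordered by reverse inclusion. Greatest lower bounds are unions, a
  colouring with \<open>k\<close> colours gives the chain condition, and the filter becomes a
  directed subfamily of \<open>\<F>\<close>.\<close>

lemma GMA_subsets:
  fixes \<F> :: "'u set set"
  assumes GMA: "GMA TYPE('p) k"
    and size: "|\<F>| \<le>o |UNIV :: 'p set|"
    and Un: "\<And>F F' H. \<lbrakk>F \<in> \<F>; F' \<in> \<F>; H \<in> \<F>; F \<union> F' \<subseteq> H\<rbrakk> \<Longrightarrow> F \<union> F' \<in> \<F>"
    and chain: "\<And>\<xi> F. \<lbrakk>\<xi> \<in> Field k; \<And>\<alpha>. \<alpha> \<in> underS k \<xi> \<Longrightarrow> F \<alpha> \<in> \<F>;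
        \<And>\<alpha> \<beta>. \<lbrakk>\<alpha> \<in> underS k \<xi>; \<beta> \<in> underS k \<xi>; (\<alpha>, \<beta>) \<in> k\<rbrakk> \<Longrightarrow> F \<alpha> \<subseteq> F \<beta>\<rbrakk>
        \<Longrightarrow> (\<Union>\<alpha> \<in> underS k \<xi>. F \<alpha>) \<in> \<F>"
    and col: "\<And>F. F \<in> \<F> \<Longrightarrow> col F \<in> Field k"
    and linked: "\<And>F F'. \<lbrakk>F \<in> \<F>; F' \<in> \<F>; col F = col F'\<rbrakk> \<Longrightarrow> F \<union> F' \<in> \<F>"
    and dense: "\<And>j F. \<lbrakk>j \<in> J; F \<in> \<F>\<rbrakk> \<Longrightarrow> \<exists>F' \<in> \<F>. F \<subseteq> F' \<and> Q j F'"
    and J: "|J| <o ctwo ^c k"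
  shows "\<exists>\<G> \<subseteq> \<F>. (\<forall>F \<in> \<G>. \<forall>F' \<in> \<G>. \<exists>H \<in> \<G>. F \<union> F' \<subseteq> H) \<and> (\<forall>j \<in> J. \<exists>F \<in> \<G>. Q j F)"
proof -
  \<comment> \<open>\<open>GMA\<close> speaks only of orders on the type \<open>'p\<close>, so
    \<open>\<F>\<close> is copied into that type; \<open>\<delta>\<close> decodes.\<close>
  obtain \<pi> :: "'u set \<Rightarrow> 'p" where \<pi>: "inj_on \<pi> \<F>"
    using size unfolding card_of_ordLeq[symmetric] by blast
  define P where "P = \<pi> ` \<F>"
  define \<delta> where "\<delta> = inv_into \<F> \<pi>"
  have \<delta>: "\<delta> (\<pi> F) = F" if "F \<in> \<F>" for F
    using that \<pi> unfolding \<delta>_def by simp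
  have inv: "\<delta> p \<in> \<F>" "\<pi> (\<delta> p) = p" if "p \<in> P" for p
    using that \<delta> unfolding P_def by auto
  define R where "R = {(p, q). p \<in> P \<and> q \<in> P \<and> \<delta> q \<subseteq> \<delta> p}"
  have R: "(\<pi> F, \<pi> F') \<in> R \<longleftrightarrow> F' \<subseteq> F" if "F \<in> \<F>" "F' \<in> \<F>" for F F'
    using that \<delta> unfolding R_def P_def by simp
  have po: "partial_order_on P R"
    unfolding partial_order_on_def preorder_on_def refl_on_def trans_def antisym_def
  proof (intro conjI allI impI ballI)
    show "x = y" if "(x, y) \<in> R" "(y, x) \<in> R" for x y
    proof -
      have "\<delta> x = \<delta> y" "x \<in> P" "y \<in> P" using that unfolding R_def by auto
      then show ?thesis using inv by metis
    qed
  qed (auto simp: R_def)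
  have comp: "compatible P R (\<pi> F) (\<pi> F') \<longleftrightarrow> (\<exists>H \<in> \<F>. F \<union> F' \<subseteq> H)"
    if "F \<in> \<F>" "F' \<in> \<F>" for F F'
    unfolding compatible_def
  proof
    assume "\<exists>s \<in> P. (s, \<pi> F) \<in> R \<and> (s, \<pi> F') \<in> R"
    then show "\<exists>H \<in> \<F>. F \<union> F' \<subseteq> H" using R that unfolding P_def by auto
  next
    assume "\<exists>H \<in> \<F>. F \<union> F' \<subseteq> H"
    then obtain H where "H \<in> \<F>" "F \<subseteq> H" "F' \<subseteq> H" by blast
    then have "\<pi> H \<in> P" "(\<pi> H, \<pi> F) \<in> R" "(\<pi> H, \<pi> F') \<in> R"
      using R that unfolding P_def by simp_all
    then show "\<exists>s \<in> P. (s, \<pi> F) \<in> R \<and> (s, \<pi> F') \<in> R" by blast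
  qed
  \<comment> \<open>For empty \<open>\<A>\<close> this makes the empty set the largest condition,
    which the sequence of length 0 requires.\<close>
  have glb: "is_glb P R (\<pi> ` \<A>) (\<pi> (\<Union>\<A>))" if "\<A> \<subseteq> \<F>" "\<Union>\<A> \<in> \<F>" for \<A>
  proof -
    have "(\<pi> (\<Union>\<A>), \<pi> F) \<in> R" if "F \<in> \<A>" for F
      using that \<open>\<A> \<subseteq> \<F>\<close> \<open>\<Union>\<A> \<in> \<F>\<close> R by blast
    moreover have "(\<pi> H, \<pi> (\<Union>\<A>)) \<in> R" if H: "H \<in> \<F>" "\<forall>F \<in> \<A>. (\<pi> H, \<pi> F) \<in> R" for H
    proof -
      have "\<forall>F \<in> \<A>. F \<subseteq> H" using H R \<open>\<A> \<subseteq> \<F>\<close> by blast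
      then show ?thesis using R H(1) \<open>\<Union>\<A> \<in> \<F>\<close> by blast
    qed
    ultimately show ?thesis using that unfolding is_glb_def P_def by auto
  qed
  have bin: "binary_glbs P R"
    unfolding binary_glbs_def
  proof (intro ballI impI)
    fix p q assume "p \<in> P" "q \<in> P" and pq: "compatible P R p q"
    then obtain F F' where F: "F \<in> \<F>" "F' \<in> \<F>" "p = \<pi> F" "q = \<pi> F'"
      unfolding P_def by blast
    then have "F \<union> F' \<in> \<F>" using comp pq Un by blast
    then have "is_glb P R {p, q} (\<pi> (F \<union> F'))" using glb[of "{F, F'}"] F by simp
    then show "\<exists>g. is_glb P R {p, q} g" by blast
  qed
  have short: "short_sequence_glbs k P R"
    unfolding short_sequence_glbs_def
  proof (intro ballI allI impI, elim conjE)
    fix \<xi> and p :: "'k \<Rightarrow> 'p"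
    assume \<xi>: "\<xi> \<in> Field k" and p: "\<forall>\<alpha> \<in> underS k \<xi>. p \<alpha> \<in> P"
      and dec: "\<forall>\<alpha> \<in> underS k \<xi>. \<forall>\<beta> \<in> underS k \<xi>. (\<alpha>, \<beta>) \<in> k \<longrightarrow> (p \<beta>, p \<alpha>) \<in> R"
    have "\<forall>\<alpha> \<in> underS k \<xi>. \<exists>F. F \<in> \<F> \<and> p \<alpha> = \<pi> F" using p unfolding P_def by blast
    then obtain F where F: "\<And>\<alpha>. \<alpha> \<in> underS k \<xi> \<Longrightarrow> F \<alpha> \<in> \<F> \<and> p \<alpha> = \<pi> (F \<alpha>)" by metis
    have "F \<alpha> \<subseteq> F \<beta>" if "\<alpha> \<in> underS k \<xi>" "\<beta> \<in> underS k \<xi>" "(\<alpha>, \<beta>) \<in> k" for \<alpha> \<beta>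
      using dec that F R by metis
    then have "(\<Union>\<alpha> \<in> underS k \<xi>. F \<alpha>) \<in> \<F>" using chain[OF \<xi>, of F] F by blast
    then have "is_glb P R (\<pi> ` F ` underS k \<xi>) (\<pi> (\<Union>\<alpha> \<in> underS k \<xi>. F \<alpha>))"
      using glb[of "F ` underS k \<xi>"] F by blast
    moreover have "\<pi> ` F ` underS k \<xi> = p ` underS k \<xi>" using F by (force simp: image_image)
    ultimately show "\<exists>g. is_glb P R (p ` underS k \<xi>) g" by auto
  qed
  have scc: "stationary_chain_condition k P R"
  proof (rule stationary_chain_condition_colouring)
    show "col (\<delta> p) \<in> Field k" if "p \<in> P" for p using inv[OF that] col by blast
    fix p q assume "p \<in> P" "q \<in> P" and "col (\<delta> p) = col (\<delta> q)"
    then show "compatible P R p q"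
      using inv[of p] inv[of q] comp[of "\<delta> p" "\<delta> q"] linked by auto
  qed
  define D where "D j = \<pi> ` {F \<in> \<F>. Q j F}" for j
  have D: "dense_in P R (D j)" if "j \<in> J" for j
    unfolding dense_in_def
  proof (intro conjI ballI)
    show "D j \<subseteq> P" unfolding D_def P_def by blast
    fix p assume "p \<in> P"
    then obtain F where F: "F \<in> \<F>" "p = \<pi> F" unfolding P_def by blast
    then obtain F' where "F' \<in> \<F>" "F \<subseteq> F'" "Q j F'" using dense \<open>j \<in> J\<close> by metis
    then have "\<pi> F' \<in> D j" "(\<pi> F', p) \<in> R" using F R unfolding D_def by simp_all
    then show "\<exists>d \<in> D j. (d, p) \<in> R" by blast
  qed
  moreover have "|D ` J| <o ctwo ^c k" using card_of_image[of D J] J by (rule ordLeq_ordLess_trans)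
  ultimately have "(\<forall>D' \<in> D ` J. dense_in P R D') \<and> |D ` J| <o ctwo ^c k" by simp
  then have "\<exists>G. filter_in P R G \<and> (\<forall>D' \<in> D ` J. G \<inter> D' \<noteq> {})"
    using GMA[unfolded GMA_def, THEN spec[of _ P], THEN spec[of _ R]] po bin short scc
    by (blast dest: spec[of _ "D ` J"])
  then obtain G where "filter_in P R G \<and> (\<forall>D' \<in> D ` J. G \<inter> D' \<noteq> {})" by (rule exE)
  then have G: "filter_in P R G" "\<And>j. j \<in> J \<Longrightarrow> G \<inter> D j \<noteq> {}" by simp_all
  define \<G> where "\<G> = {F \<in> \<F>. \<pi> F \<in> G}"
  have dir: "\<exists>H \<in> \<G>. F \<union> F' \<subseteq> H" if FF: "F \<in> \<G>" "F' \<in> \<G>" for F F'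
  proof -
    obtain s where s: "s \<in> G" "(s, \<pi> F) \<in> R" "(s, \<pi> F') \<in> R"
      using FF G(1) unfolding \<G>_def filter_in_def by blast
    then obtain H where "H \<in> \<F>" "s = \<pi> H" using G(1) unfolding filter_in_def P_def by blast
    moreover from this have "F \<subseteq> H" "F' \<subseteq> H" using s R FF unfolding \<G>_def by simp_all
    ultimately show ?thesis using s(1) unfolding \<G>_def by blast
  qed
  have meets: "\<exists>F \<in> \<G>. Q j F" if "j \<in> J" for j
    using G(2)[OF that] unfolding D_def \<G>_def by blast
  show ?thesis
  proof (intro exI[of _ \<G>] conjI ballI)
    show "\<G> \<subseteq> \<F>" unfolding \<G>_def by blast
  qed (fact dir meets)+
qed

text \<open>A nonempty small subset of \<open>U\<close> is the range of a function from
  \<open>k\<close> to \<open>U\<close>, and \<open>(2^k)^k = 2^k\<close>. Hence all conditions fit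
  into the universe of \<open>GMA\<close>.\<close>

lemma card_small_subsets:
  assumes U: "|U| \<le>o ctwo ^c k"
  shows "|{F. F \<subseteq> U \<and> |F| <o k}| \<le>o ctwo ^c k"
proof -
  have "{F. F \<subseteq> U \<and> |F| <o k} \<subseteq> {{}} \<union> (\<lambda>g. g ` Field k) ` Func (Field k) U"
  proof
    fix F assume F: "F \<in> {F. F \<subseteq> U \<and> |F| <o k}"
    show "F \<in> {{}} \<union> (\<lambda>g. g ` Field k) ` Func (Field k) U"
    \<comment> \<open>The empty set is counted separately, since it is not the image of the nonempty
      set \<open>Field k\<close>.\<close>
    proof (cases "F = {}")
      case False
      have "|F| \<le>o |Field k|"
        using F card_of_Field_ordIso[OF card] ordIso_symmetric ordLess_ordIso_trans
          ordLess_imp_ordLeq by blast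
      then obtain g where g: "g ` Field k = F"
        using iffD2[OF card_of_ordLeq2[OF False]] by blast
      define g' where "g' x = (if x \<in> Field k then g x else undefined)" for x
      have "g' \<in> Func (Field k) U" "F = g' ` Field k"
        using g F unfolding g'_def Func_def by auto
      then show ?thesis by blast
    qed simp
  qed
  moreover have "|Func (Field k) U| \<le>o ctwo ^c k"
  proof -
    have "|Func (Field k) U| = |U| ^c k" by (simp add: cexp_def Field_card_of)
    also have "( |U| ^c k) \<le>o (ctwo ^c k) ^c k" using cexp_mono1[OF U card] .
    also have "(ctwo ^c k) ^c k =o ctwo ^c k"
      using cexp_cprod_ordLeq[OF Card_order_ctwo Cinf Cinfinite_Cnotzero[OF Cinf]] card
      by (simp add: card_order_on_def)
    finally show ?thesis .
  qed
  then have "|(\<lambda>g. g ` Field k) ` Func (Field k) U| \<le>o ctwo ^c k"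
    using card_of_image ordLeq_transitive by blast
  moreover have C: "Cinfinite (ctwo ^c k)"
    using Cinfinite_cexp[OF ordLeq_refl[OF Card_order_ctwo] Cinf] .
  moreover have "|{{}}| \<le>o ctwo ^c k"
    using C by (intro Card_order_singl_ordLeq) (auto simp: cinfinite_def)
  ultimately show ?thesis
    using Un_Cinfinite_bound card_of_mono1 ordLeq_transitive by meson
qed

text \<open>A restriction on triples has finite character: any three elements of a directed union
  already lie in one member. So unions of short chains, and unions of two conditions with a common
  extension, are again conditions. Density reduces to adding a single element.\<close>

lemma GMA_triples:
  fixes U :: "'u set" and bad :: "'u \<Rightarrow> 'u \<Rightarrow> 'u \<Rightarrow> bool"
  defines "\<F> \<equiv> {F. F \<subseteq> U \<and> |F| <o k \<and> (\<forall>u \<in> F. \<forall>v \<in> F. \<forall>w \<in> F. \<not> bad u v w)}"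
  assumes GMA: "GMA TYPE('p) k"
    and universe: "ctwo ^c k \<le>o |UNIV :: 'p set|"
    and U: "|U| \<le>o ctwo ^c k"
    and col: "\<And>F. F \<in> \<F> \<Longrightarrow> col F \<in> Field k"
    and linked: "\<And>F F' u v w. \<lbrakk>F \<in> \<F>; F' \<in> \<F>; col F = col F';
        u \<in> F \<union> F'; v \<in> F \<union> F'; w \<in> F \<union> F'\<rbrakk> \<Longrightarrow> \<not> bad u v w"
    and dense: "\<And>j F. \<lbrakk>j \<in> J; F \<in> \<F>\<rbrakk> \<Longrightarrow> \<exists>u \<in> E j. insert u F \<in> \<F>"
    and J: "|J| <o ctwo ^c k"
  shows "\<exists>G \<subseteq> U. (\<forall>u \<in> G. \<forall>v \<in> G. \<forall>w \<in> G. \<not> bad u v w) \<and> (\<forall>j \<in> J. E j \<inter> G \<noteq> {})"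
proof -
  have "\<F> \<subseteq> {F. F \<subseteq> U \<and> |F| <o k}" unfolding \<F>_def by blast
  then have size: "|\<F>| \<le>o |UNIV :: 'p set|"
    using card_small_subsets[OF U] universe card_of_mono1 ordLeq_transitive by meson
  have "\<exists>\<G> \<subseteq> \<F>. (\<forall>F \<in> \<G>. \<forall>F' \<in> \<G>. \<exists>H \<in> \<G>. F \<union> F' \<subseteq> H) \<and>
      (\<forall>j \<in> J. \<exists>F \<in> \<G>. E j \<inter> F \<noteq> {})"
  proof (rule GMA_subsets[OF GMA size])
    show "F \<union> F' \<in> \<F>" if "F \<in> \<F>" "F' \<in> \<F>" "H \<in> \<F>" "F \<union> F' \<subseteq> H" for F F' H
      using that small_Un[of F F'] unfolding \<F>_def by blast
    show "(\<Union>\<alpha> \<in> underS k \<xi>. F \<alpha>) \<in> \<F>"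
      if \<xi>: "\<xi> \<in> Field k" and F: "\<And>\<alpha>. \<alpha> \<in> underS k \<xi> \<Longrightarrow> F \<alpha> \<in> \<F>"
        and inc: "\<And>\<alpha> \<beta>. \<lbrakk>\<alpha> \<in> underS k \<xi>; \<beta> \<in> underS k \<xi>; (\<alpha>, \<beta>) \<in> k\<rbrakk> \<Longrightarrow> F \<alpha> \<subseteq> F \<beta>"
      for \<xi> F
    proof -
      have "|\<Union>\<alpha> \<in> underS k \<xi>. F \<alpha>| <o k"
        using small_UN card_of_underS[OF card \<xi>] F unfolding \<F>_def by blast
      moreover have "\<not> bad u v w" if uvw: "u \<in> F a" "v \<in> F b" "w \<in> F c"
        and abc: "a \<in> underS k \<xi>" "b \<in> underS k \<xi>" "c \<in> underS k \<xi>" for u v w a b c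
      proof -
        \<comment> \<open>The later of two members of the chain contains both; two applications
          place \<open>u\<close>, \<open>v\<close>, \<open>w\<close> in one member.\<close>
        have mx: "\<exists>d \<in> underS k \<xi>. F x \<subseteq> F d \<and> F y \<subseteq> F d"
          if "x \<in> underS k \<xi>" "y \<in> underS k \<xi>" for x y
          using wo_rel.TOTALS[OF wo] inc that underS_in_Field by (metis order_refl)
        obtain d where d: "d \<in> underS k \<xi>" "F a \<subseteq> F d" "F b \<subseteq> F d"
          using mx[OF abc(1,2)] by blast
        obtain e where e: "e \<in> underS k \<xi>" "F d \<subseteq> F e" "F c \<subseteq> F e"
          using mx[OF d(1) abc(3)] by blast
        have "u \<in> F e" "v \<in> F e" "w \<in> F e" using d e uvw by blast+
        then show ?thesis using F[OF e(1), unfolded \<F>_def] by simp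
      qed
      moreover have "(\<Union>\<alpha> \<in> underS k \<xi>. F \<alpha>) \<subseteq> U" using F unfolding \<F>_def by blast
      ultimately show ?thesis unfolding \<F>_def by blast
    qed
    show "col F \<in> Field k" if "F \<in> \<F>" for F using col that .
    show "F \<union> F' \<in> \<F>" if "F \<in> \<F>" "F' \<in> \<F>" "col F = col F'" for F F'
    proof -
      have "|F \<union> F'| <o k" "F \<union> F' \<subseteq> U" using that small_Un[of F F'] unfolding \<F>_def by blast+
      then show ?thesis using linked[OF that] unfolding \<F>_def by blast
    qed
    show "\<exists>F' \<in> \<F>. F \<subseteq> F' \<and> E j \<inter> F' \<noteq> {}" if "j \<in> J" "F \<in> \<F>" for j F
      using dense[OF that] by blast
  qed (rule J)
  then obtain \<G> where \<G>': "\<G> \<subseteq> \<F>" "\<forall>F \<in> \<G>. \<forall>F' \<in> \<G>. \<exists>H \<in> \<G>. F \<union> F' \<subseteq> H"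
    "\<forall>j \<in> J. \<exists>F \<in> \<G>. E j \<inter> F \<noteq> {}" by (elim exE conjE)
  then have \<G>: "\<G> \<subseteq> \<F>" "\<And>F F'. \<lbrakk>F \<in> \<G>; F' \<in> \<G>\<rbrakk> \<Longrightarrow> \<exists>H \<in> \<G>. F \<union> F' \<subseteq> H"
    "\<And>j. j \<in> J \<Longrightarrow> \<exists>F \<in> \<G>. E j \<inter> F \<noteq> {}" by simp_all
  have ok: "\<not> bad u v w" if uvw: "u \<in> \<Union>\<G>" "v \<in> \<Union>\<G>" "w \<in> \<Union>\<G>" for u v w
  proof -
    obtain F1 F2 F3 where F: "F1 \<in> \<G>" "u \<in> F1" "F2 \<in> \<G>" "v \<in> F2" "F3 \<in> \<G>" "w \<in> F3"
      using uvw by blast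
    obtain H where H: "H \<in> \<G>" "F1 \<union> F2 \<subseteq> H" using \<G>(2)[OF F(1,3)] by blast
    obtain H' where H': "H' \<in> \<G>" "H \<union> F3 \<subseteq> H'" using \<G>(2)[OF H(1) F(5)] by blast
    then have "u \<in> H'" "v \<in> H'" "w \<in> H'" "H' \<in> \<F>" using F H \<G>(1) by auto
    then show ?thesis unfolding \<F>_def by simp
  qed
  show ?thesis
  proof (intro exI[of _ "\<Union>\<G>"] conjI ballI)
    show "\<Union>\<G> \<subseteq> U" using \<G>(1) unfolding \<F>_def by blast
    show "E j \<inter> \<Union>\<G> \<noteq> {}" if "j \<in> J" for j using \<G>(3)[OF that] by blast
  qed (rule ok)
qed

text \<open>The colour of F codes its trace below \<open>r F\<close>.\<close>

lemma small_family_colouring: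
  fixes E :: "'u \<Rightarrow> 'k \<Rightarrow> 'k" and r :: "'u set \<Rightarrow> 'k"
  assumes E: "\<And>F u x. \<lbrakk>F \<in> \<S>; u \<in> F; x \<in> Field k\<rbrakk> \<Longrightarrow> E u x \<in> Field k"
    and r: "\<And>F. F \<in> \<S> \<Longrightarrow> r F \<in> Field k"
    and small: "\<And>F. F \<in> \<S> \<Longrightarrow> |F| <o k"
  obtains col where "\<And>F. F \<in> \<S> \<Longrightarrow> col F \<in> Field k"
    and "\<And>F F' u. \<lbrakk>F \<in> \<S>; F' \<in> \<S>; col F = col F'; u \<in> F\<rbrakk> \<Longrightarrow>
      r F = r F' \<and> (\<exists>u' \<in> F'. \<forall>x \<in> underS k (r F). E u x = E u' x)"
proof -
  let ?S = "SIGMA \<xi> : Field k. Func (underS k \<xi>) (Field k)"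
  obtain \<nu> where "bij_betw \<nu> ?S (Field k)" using ex_coding by blast
  then have \<nu>: "\<And>a. a \<in> ?S \<Longrightarrow> \<nu> a \<in> Field k" "\<And>a b. \<lbrakk>a \<in> ?S; b \<in> ?S; \<nu> a = \<nu> b\<rbrakk> \<Longrightarrow> a = b"
    unfolding bij_betw_def inj_on_def by blast+
  have "\<forall>F \<in> \<S>. \<exists>p. fst p \<in> Field k \<and> bij_betw (snd p) (underS k (fst p)) F"
  proof
    fix F assume "F \<in> \<S>"
    then obtain \<xi> h where "\<xi> \<in> Field k" "bij_betw h (underS k \<xi>) F"
      using small_bij[OF small] by blast
    then show "\<exists>p. fst p \<in> Field k \<and> bij_betw (snd p) (underS k (fst p)) F"
      by (intro exI[of _ "(\<xi>, h)"]) simp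
  qed
  from bchoice[OF this] obtain p where p: "\<forall>F \<in> \<S>. fst (p F) \<in> Field k \<and> bij_betw (snd (p F)) (underS k (fst (p F))) F"
    by blast
  define \<xi> h where "\<xi> F = fst (p F)" and "h F = snd (p F)" for F
  have \<xi>: "\<And>F. F \<in> \<S> \<Longrightarrow> \<xi> F \<in> Field k"
    and h: "\<And>F. F \<in> \<S> \<Longrightarrow> h F ` underS k (\<xi> F) = F"
    using p unfolding \<xi>_def h_def bij_betw_def by simp_all
  \<comment> \<open>Coding happens twice: \<open>code\<close> is the row of \<open>u\<close> below
    \<open>\<rho>\<close>, and \<open>seq\<close> lists the codes of these rows along the
    enumeration of \<open>F\<close>. The value \<open>undefined\<close> outside the domains makes
    both elements of \<open>Func\<close>.\<close>
  define code where "code \<rho> u = (\<rho>, \<lambda>x. if x \<in> underS k \<rho> then E u x else undefined)" for \<rho> u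
  define seq where "seq F = (\<xi> F, \<lambda>\<gamma>. if \<gamma> \<in> underS k (\<xi> F) then \<nu> (code (r F) (h F \<gamma>)) else undefined)" for F
  have code: "code (r F) u \<in> ?S" if "F \<in> \<S>" "u \<in> F" for F u
    using r[OF that(1)] E[OF that] underS_in_Field unfolding code_def Func_def by auto
  have seq: "seq F \<in> ?S" if "F \<in> \<S>" for F
    using \<xi>[OF that] h[OF that] \<nu>(1)[OF code[OF that]] unfolding seq_def Func_def by auto
  show ?thesis
  proof (rule that[of "\<lambda>F. \<nu> (seq F)"])
    show "\<nu> (seq F) \<in> Field k" if "F \<in> \<S>" for F using \<nu>(1)[OF seq[OF that]] .
    fix F F' u assume F: "F \<in> \<S>" "F' \<in> \<S>" and "\<nu> (seq F) = \<nu> (seq F')" and u: "u \<in> F"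
    then have eq: "seq F = seq F'" using \<nu>(2) seq by blast
    obtain \<gamma> where \<gamma>: "\<gamma> \<in> underS k (\<xi> F)" "u = h F \<gamma>" using u h[OF F(1)] by blast
    \<comment> \<open>Equal colours give equal lengths, so the position of \<open>u\<close> in
      \<open>F\<close> is also a position in \<open>F'\<close>; the element found there is its
      partner.\<close>
    have \<gamma>': "\<gamma> \<in> underS k (\<xi> F')" using eq \<gamma> unfolding seq_def by simp
    then have u': "h F' \<gamma> \<in> F'" using h[OF F(2)] by blast
    have "snd (seq F) \<gamma> = snd (seq F') \<gamma>" using eq by simp
    then have "\<nu> (code (r F) u) = \<nu> (code (r F') (h F' \<gamma>))"
      using \<gamma> \<gamma>' unfolding seq_def by simp
    then have "code (r F) u = code (r F') (h F' \<gamma>)"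
      using \<nu>(2) code F u u' by blast
    then have "r F = r F'" and "\<And>x. x \<in> underS k (r F) \<Longrightarrow> E u x = E (h F' \<gamma>) x"
      unfolding code_def by (auto simp: fun_eq_iff) metis
    then show "r F = r F' \<and> (\<exists>u' \<in> F'. \<forall>x \<in> underS k (r F). E u x = E u' x)"
      using u' by blast
  qed
qed

subsection \<open>Nodes and slots\<close>

text \<open>The restriction of \<open>i\<close> to \<open>\<beta>\<close>, normalized outside
  \<open>\<beta>\<close> so that two branches pass through the same node of level
  \<open>\<beta>\<close> exactly when their cuts are equal.\<close>

definition cut :: "'k \<Rightarrow> ('k \<Rightarrow> bool) \<Rightarrow> 'k \<Rightarrow> bool" where
  "cut \<beta> i = (\<lambda>x. if x \<in> underS k \<beta> then i x else undefined)"

lemma cut_in_seqs2: "cut \<beta> i \<in> seqs2 k \<beta>"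
  unfolding cut_def seqs2_def Func_def by simp

lemma cut_eq_iff: "cut \<beta> i = cut \<beta> j \<longleftrightarrow> (\<forall>x \<in> underS k \<beta>. i x = j x)"
  unfolding cut_def by (auto simp: fun_eq_iff)

lemma cut_mono: "\<lbrakk>cut \<beta> i = cut \<beta> j; (\<alpha>, \<beta>) \<in> k\<rbrakk> \<Longrightarrow> cut \<alpha> i = cut \<alpha> j"
  unfolding cut_eq_iff using underS_le_trans by blast

lemma space2_eqI:
  assumes "i \<in> space2 k" "j \<in> space2 k" "\<And>x. x \<in> Field k \<Longrightarrow> i x = j x"
  shows "i = j"
  using assms unfolding space2_def Func_def by (fastforce simp: fun_eq_iff)

text \<open>The level is stored with the sequence: \<open>undefined\<close> is itself a truth value,
  so sequences of different lengths may coincide as functions.\<close>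

definition nodes :: "('k \<times> ('k \<Rightarrow> bool)) set" where
  "nodes = (SIGMA \<beta> : Field k. seqs2 k \<beta>)"

text \<open>Replacing the two truth values by two elements of \<open>k\<close> embeds the binary
  sequences into the \<open>k\<close>-valued sequences of the same length.\<close>

lemma card_nodes: "|nodes| \<le>o k"
proof -
  obtain x0 where x0: "x0 \<in> Field k" using infinite by fastforce
  obtain x1 where x1: "x1 \<in> Field k" "x1 \<noteq> x0"
    using ex_above[OF x0] unfolding underS_def by blast
  have "|seqs2 k \<beta>| \<le>o |Func (underS k \<beta>) (Field k)|" for \<beta>
  proof (rule card_of_ordLeqI)
    let ?e = "\<lambda>f x. if x \<in> underS k \<beta> then if f x then x1 else x0 else undefined"
    show "inj_on ?e (seqs2 k \<beta>)"
    proof (rule inj_onI, rule ext)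
      fix f g x assume "f \<in> seqs2 k \<beta>" "g \<in> seqs2 k \<beta>" and eq: "?e f = ?e g"
      then show "f x = g x"
        using fun_cong[OF eq, of x] x1(2) unfolding seqs2_def Func_def
        by (cases "x \<in> underS k \<beta>") (auto split: if_splits)
    qed
    show "?e f \<in> Func (underS k \<beta>) (Field k)" for f
      using x0 x1(1) unfolding Func_def by simp
  qed
  then have "|nodes| \<le>o |SIGMA \<beta> : Field k. Func (underS k \<beta>) (Field k)|"
    unfolding nodes_def by (intro card_of_Sigma_mono1) blast
  then show ?thesis
    using power ordIso_symmetric ordLeq_ordIso_trans unfolding eq_lt_power_def by blast
qed

section \<open>Sizes of products and of tails\<close>

lemma card_bool: "|UNIV :: bool set| \<le>o k"
  using ctwo_ordLeq_Cinfinite[OF Cinf] unfolding ctwo_def .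

lemma card_Times: "\<lbrakk>|A| \<le>o k; |B| \<le>o k\<rbrakk> \<Longrightarrow> |A \<times> B| \<le>o k"
  using card_of_Times_ordLeq_infinite_Field[OF infinite _ _ card] by blast

lemma inj_into:
  assumes "|B| \<le>o k" "|X| =o k"
  obtains \<sigma> where "inj_on \<sigma> B" "\<sigma> ` B \<subseteq> X"
proof -
  have "|B| \<le>o |X|" using assms ordIso_symmetric ordLeq_ordIso_trans by blast
  then show ?thesis using iffD2[OF card_of_ordLeq] that by metis
qed

text \<open>The complement of the tail is a proper initial segment, hence small. Thus the lengths
  belonging to the levels from \<open>c\<close> on form an admissible set in the definition of
  strong measure zero.\<close>

lemma card_tail:
  assumes "c \<in> Field k"
  shows "|{\<beta> \<in> Field k. (c, \<beta>) \<in> k}| =o k"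
proof -
  let ?T = "{\<beta> \<in> Field k. (c, \<beta>) \<in> k}"
  have "|?T| \<le>o |Field k|" by (rule card_of_mono1) blast
  then have le: "|?T| \<le>o k" using card_of_Field_ordIso[OF card] ordLeq_ordIso_trans by blast
  have "\<not> |?T| <o k"
  proof
    assume "|?T| <o k"
    then have "|underS k c \<union> ?T| <o k" using small_Un card_of_underS[OF card assms] by blast
    moreover have "Field k \<subseteq> underS k c \<union> ?T" using underS_or_le assms by blast
    ultimately have "|Field k| <o k" using small_subset by blast
    then show False using card_of_Field_ordIso[OF card] not_ordLess_ordIso by blast
  qed
  with le show ?thesis by (simp add: ordLeq_iff_ordLess_or_ordIso)
qed

end

subsection \<open>The forcing\<close>

text \<open>A pair \<open>u = (i, c)\<close> promises that, for all \<open>\<beta> \<ge> c\<close>, one of the two slots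
  belonging to the node \<open>i \<restriction> \<beta>\<close> receives the sequence \<open>f u (m (i \<restriction> \<beta>))\<close>.\<close>

locale promises = power_card k for k :: "'k rel" +
  fixes I :: "('k \<Rightarrow> bool) set"
    and m :: "'k \<times> ('k \<Rightarrow> bool) \<Rightarrow> 'k"
    and f :: "('k \<Rightarrow> bool) \<times> 'k \<Rightarrow> 'k \<Rightarrow> 'k \<Rightarrow> bool"
  assumes I: "I \<subseteq> space2 k"
    and m: "n \<in> nodes \<Longrightarrow> m n \<in> Field k"
    and f: "\<lbrakk>u \<in> I \<times> Field k; (snd u, \<beta>) \<in> k\<rbrakk> \<Longrightarrow>
      f u (m (\<beta>, cut \<beta> (fst u))) \<in> seqs2 k (m (\<beta>, cut \<beta> (fst u)))"
begin

text \<open>The value is a node in any case, so that it can be coded by an element of \<open>Field k\<close>.\<close>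

definition val :: "('k \<Rightarrow> bool) \<times> 'k \<Rightarrow> 'k \<Rightarrow> 'k \<times> ('k \<Rightarrow> bool)" where
  "val u \<beta> = (let n = (\<beta>, cut \<beta> (fst u)) in if (snd u, \<beta>) \<in> k then (m n, f u (m n)) else n)"

text \<open>Too much for two slots: three promises active at a common node ask for three different
  sequences. Since the node is common, the values have the same first component \<open>m n\<close>
  and differ in the sequence.\<close>

definition overfull where
  "overfull u v w \<longleftrightarrow> (\<exists>\<beta>. (snd u, \<beta>) \<in> k \<and> (snd v, \<beta>) \<in> k \<and> (snd w, \<beta>) \<in> k \<and>
    cut \<beta> (fst u) = cut \<beta> (fst v) \<and> cut \<beta> (fst v) = cut \<beta> (fst w) \<and>
    val u \<beta> \<noteq> val v \<beta> \<and> val v \<beta> \<noteq> val w \<beta> \<and> val u \<beta> \<noteq> val w \<beta>)"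

text \<open>The first clause makes a condition a partial function from branches to levels. It
  ignores \<open>w\<close>, so that both restrictions take the form of one relation on
  triples.\<close>

definition bad where
  "bad u v w \<longleftrightarrow> fst u = fst v \<and> u \<noteq> v \<or> overfull u v w"

definition conds where
  "conds = {F. F \<subseteq> I \<times> Field k \<and> |F| <o k \<and> (\<forall>u \<in> F. \<forall>v \<in> F. \<forall>w \<in> F. \<not> bad u v w)}"

section \<open>Separation and amalgamation of conditions\<close>

lemma val_in_nodes:
  assumes "u \<in> I \<times> Field k" "\<beta> \<in> Field k"
  shows "val u \<beta> \<in> nodes"
  using f[OF assms(1), of \<beta>] m[of "(\<beta>, cut \<beta> (fst u))"] assms cut_in_seqs2[of \<beta> "fst u"]
  unfolding val_def nodes_def by (simp add: Let_def)

lemma conds_inj: "\<lbrakk>F \<in> conds; u \<in> F; v \<in> F; fst u = fst v\<rbrakk> \<Longrightarrow> u = v"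
  unfolding conds_def bad_def by blast

lemma fst_separated:
  assumes "i \<in> I" "j \<in> I" "i \<noteq> j"
  shows "\<exists>\<delta> \<in> Field k. i \<delta> \<noteq> j \<delta>"
  using space2_eqI[of i j] assms I by blast

text \<open>Choose one coordinate of difference for each pair of promises. By regularity the set of
  these coordinates is small, hence bounded.\<close>

lemma ex_separating:
  assumes F: "F \<in> conds"
  shows "\<exists>\<rho>. \<rho> \<in> Field k \<and> underS k \<rho> \<noteq> {} \<and>
    (\<forall>u \<in> F. \<forall>v \<in> F. cut \<rho> (fst u) = cut \<rho> (fst v) \<longrightarrow> u = v)"
proof -
  have "\<forall>u \<in> F. \<forall>v \<in> F. u \<noteq> v \<longrightarrow> (\<exists>\<delta> \<in> Field k. fst u \<delta> \<noteq> fst v \<delta>)"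
  proof (intro ballI impI)
    fix u v assume uv: "u \<in> F" "v \<in> F" "u \<noteq> v"
    then have "fst u \<noteq> fst v" using conds_inj[OF F] by blast
    moreover have "fst u \<in> I" "fst v \<in> I" using F uv unfolding conds_def by auto
    ultimately show "\<exists>\<delta> \<in> Field k. fst u \<delta> \<noteq> fst v \<delta>" by (intro fst_separated)
  qed
  then obtain \<delta> where \<delta>: "\<And>u v. \<lbrakk>u \<in> F; v \<in> F; u \<noteq> v\<rbrakk> \<Longrightarrow>
      \<delta> u v \<in> Field k \<and> fst u (\<delta> u v) \<noteq> fst v (\<delta> u v)"
    by metis
  obtain x0 where x0: "x0 \<in> Field k" using infinite by fastforce
  \<comment> \<open>The element \<open>x0\<close> makes \<open>underS k \<rho>\<close> nonempty;
    without a coordinate below \<open>\<rho>\<close>, agreement there would not determine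
    \<open>snd u\<close>.\<close>
  define K where "K = insert x0 (\<Union>u \<in> F. \<delta> u ` (F - {u}))"
  have F': "|F| <o k" using F unfolding conds_def by blast
  have "|\<delta> u ` (F - {u})| <o k" for u
    using card_of_image[of "\<delta> u" "F - {u}"] small_subset[OF _ F', of "F - {u}"]
      ordLeq_ordLess_trans by blast
  then have "|K| <o k" unfolding K_def by (intro small_insert small_UN F')
  moreover have "K \<subseteq> Field k" using x0 \<delta> unfolding K_def by auto
  ultimately obtain \<rho> where \<rho>: "\<rho> \<in> Field k" "K \<subseteq> underS k \<rho>"
    using small_bounded by blast
  moreover have "u = v" if "u \<in> F" "v \<in> F" "cut \<rho> (fst u) = cut \<rho> (fst v)" for u v
  proof (rule ccontr)
    assume "u \<noteq> v"
    then have "\<delta> u v \<in> K" using that unfolding K_def by blast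
    then show False using that(3) \<rho>(2) \<delta>[OF that(1,2) \<open>u \<noteq> v\<close>] unfolding cut_eq_iff by blast
  qed
  moreover have "underS k \<rho> \<noteq> {}" using \<rho>(2) unfolding K_def by blast
  ultimately show ?thesis by blast
qed

text \<open>A clash at a level below \<open>\<rho>\<close> is mirrored by the partners inside
  \<open>F\<close>, where it is forbidden. At a level from \<open>\<rho>\<close> on, the three
  promises agree below \<open>\<rho>\<close>, but each of \<open>F\<close> and \<open>F'\<close> has
  at most one promise through a given node of level \<open>\<rho>\<close>.\<close>

lemma conds_merge:
  assumes F: "F \<in> conds" and F': "F' \<in> conds"
    and \<rho>: "\<rho> \<in> Field k" "underS k \<rho> \<noteq> {}"
    and sep: "\<And>u v. \<lbrakk>u \<in> F; v \<in> F; cut \<rho> (fst u) = cut \<rho> (fst v)\<rbrakk> \<Longrightarrow> u = v"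
    and sep': "\<And>u v. \<lbrakk>u \<in> F'; v \<in> F'; cut \<rho> (fst u) = cut \<rho> (fst v)\<rbrakk> \<Longrightarrow> u = v"
    and partner: "\<And>u. u \<in> F' \<Longrightarrow> \<exists>u' \<in> F. \<forall>x \<in> underS k \<rho>.
      fst u' x = fst u x \<and> val u' x = val u x \<and> snd u' = snd u"
    and uvw: "u \<in> F \<union> F'" "v \<in> F \<union> F'" "w \<in> F \<union> F'"
  shows "\<not> bad u v w"
proof -
  have "\<exists>z'. z' \<in> F \<and> cut \<rho> (fst z') = cut \<rho> (fst z) \<and> snd z' = snd z \<and>
      (\<forall>x \<in> underS k \<rho>. val z' x = val z x)" if "z \<in> F \<union> F'" for z
  proof (cases "z \<in> F")
    case False
    then obtain z' where "z' \<in> F" "\<forall>x \<in> underS k \<rho>.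
        fst z' x = fst z x \<and> val z' x = val z x \<and> snd z' = snd z"
      using partner \<open>z \<in> F \<union> F'\<close> by blast
    then show ?thesis using \<rho>(2) unfolding cut_eq_iff by blast
  qed blast
  then obtain s where s: "\<And>z. z \<in> F \<union> F' \<Longrightarrow> s z \<in> F \<and> cut \<rho> (fst (s z)) = cut \<rho> (fst z) \<and>
      snd (s z) = snd z \<and> (\<forall>x \<in> underS k \<rho>. val (s z) x = val z x)"
    by metis
  \<comment> \<open>Promises on the same branch have partners with the same cut at
    \<open>\<rho>\<close>; these coincide by separation, so the second components agree.\<close>
  have "u = v" if "fst u = fst v"
  proof -
    have "s u = s v" using s[OF uvw(1)] s[OF uvw(2)] that sep by metis
    then have "snd u = snd v" using s[OF uvw(1)] s[OF uvw(2)] by metis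
    with that show ?thesis by (simp add: prod_eq_iff)
  qed
  moreover have "\<not> overfull u v w"
  proof
    assume "overfull u v w"
    then obtain \<beta> where act: "(snd u, \<beta>) \<in> k" "(snd v, \<beta>) \<in> k" "(snd w, \<beta>) \<in> k"
      and cut: "cut \<beta> (fst u) = cut \<beta> (fst v)" "cut \<beta> (fst v) = cut \<beta> (fst w)"
      and val: "val u \<beta> \<noteq> val v \<beta>" "val v \<beta> \<noteq> val w \<beta>" "val u \<beta> \<noteq> val w \<beta>"
      unfolding overfull_def by blast
    have \<beta>: "\<beta> \<in> Field k" using act(1) unfolding Field_def by blast
    show False
    proof (cases "\<beta> \<in> underS k \<rho>")
      case True
      then have "(\<beta>, \<rho>) \<in> k" unfolding underS_def by blast
      then have c: "cut \<beta> (fst (s z)) = cut \<beta> (fst z)" if "z \<in> F \<union> F'" for z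
        using s[OF that] cut_mono by blast
      have "overfull (s u) (s v) (s w)"
        unfolding overfull_def
        using act cut val True s[OF uvw(1)] s[OF uvw(2)] s[OF uvw(3)] c[OF uvw(1)] c[OF uvw(2)]
          c[OF uvw(3)] by (intro exI[of _ \<beta>]) simp
      then have "bad (s u) (s v) (s w)" unfolding bad_def by blast
      then show False using F s[OF uvw(1)] s[OF uvw(2)] s[OF uvw(3)] unfolding conds_def by blast
    next
      case False
      then have "(\<rho>, \<beta>) \<in> k" using underS_or_le[OF \<beta> \<rho>(1)] by blast
      then have "cut \<rho> (fst u) = cut \<rho> (fst v)" "cut \<rho> (fst v) = cut \<rho> (fst w)"
        using cut cut_mono by blast+
      \<comment> \<open>Different values come from different promises, and two of the three lie in
        the same condition.\<close>
      moreover have "u \<noteq> v" "v \<noteq> w" "u \<noteq> w" using val by blast+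
      ultimately show False using uvw sep sep' by (metis Un_iff)
    qed
  qed
  ultimately show ?thesis unfolding bad_def by blast
qed

text \<open>The entry of \<open>u\<close> at \<open>x\<close> codes the bit of the branch, the value
  at \<open>x\<close> and the starting level \<open>snd u\<close>; such triples number at most
  \<open>k\<close>. Equal traces below the separating ordinal \<open>r F\<close> supply the partners
  for \<open>conds_merge\<close>.\<close>

lemma conds_colouring:
  obtains col where "\<And>F. F \<in> conds \<Longrightarrow> col F \<in> Field k"
    and "\<And>F F' u v w. \<lbrakk>F \<in> conds; F' \<in> conds; col F = col F';
      u \<in> F \<union> F'; v \<in> F \<union> F'; w \<in> F \<union> F'\<rbrakk> \<Longrightarrow> \<not> bad u v w"
proof -
  have "|(UNIV :: bool set) \<times> nodes \<times> Field k| \<le>o k"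
    using card_of_Field_ordIso[OF card] ordIso_imp_ordLeq card_bool card_nodes
    by (intro card_Times) blast+
  then obtain code where code: "inj_on code ((UNIV :: bool set) \<times> nodes \<times> Field k)"
    "code ` ((UNIV :: bool set) \<times> nodes \<times> Field k) \<subseteq> Field k"
    using inj_into card_of_Field_ordIso[OF card] by metis
  define E where "E u x = code (fst u x, val u x, snd u)" for u x
  have in_code: "(fst u x, val u x, snd u) \<in> UNIV \<times> nodes \<times> Field k"
    if "F \<in> conds" "u \<in> F" "x \<in> Field k" for F u x
    using that val_in_nodes[of u x] unfolding conds_def by auto
  obtain r where r: "\<And>F. F \<in> conds \<Longrightarrow> r F \<in> Field k \<and> underS k (r F) \<noteq> {} \<and>
      (\<forall>u \<in> F. \<forall>v \<in> F. cut (r F) (fst u) = cut (r F) (fst v) \<longrightarrow> u = v)"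
    using ex_separating by metis
  obtain col where col: "\<And>F. F \<in> conds \<Longrightarrow> col F \<in> Field k"
    and E: "\<And>F F' u. \<lbrakk>F \<in> conds; F' \<in> conds; col F = col F'; u \<in> F\<rbrakk> \<Longrightarrow>
      r F = r F' \<and> (\<exists>u' \<in> F'. \<forall>x \<in> underS k (r F). E u x = E u' x)"
  proof (rule small_family_colouring[of conds E r])
    show "E u x \<in> Field k" if "F \<in> conds" "u \<in> F" "x \<in> Field k" for F u x
      using in_code[OF that] code(2) unfolding E_def by blast
    show "r F \<in> Field k" if "F \<in> conds" for F using r that by blast
    show "|F| <o k" if "F \<in> conds" for F using that unfolding conds_def by blast
  qed blast
  show ?thesis
  proof (rule that[OF col])
    fix F F' u v w
    assume F: "F \<in> conds" "F' \<in> conds" "col F = col F'"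
      and uvw: "u \<in> F \<union> F'" "v \<in> F \<union> F'" "w \<in> F \<union> F'"
    show "\<not> bad u v w"
    \<comment> \<open>The equality \<open>r F = r F'\<close> is obtained from an element of
      \<open>F'\<close>, so the empty condition is treated apart.\<close>
    proof (cases "F' = {}")
      case True
      then show ?thesis using F(1) uvw unfolding conds_def by blast
    next
      case False
      then have eq: "r F = r F'" using E[OF F(2,1) F(3)[symmetric]] by force
      show ?thesis
      proof (rule conds_merge[OF F(1,2) _ _ _ _ _ uvw, of "r F"])
        show "r F \<in> Field k" "underS k (r F) \<noteq> {}" using r[OF F(1)] by blast+
        show "z = z'" if "z \<in> F" "z' \<in> F" "cut (r F) (fst z) = cut (r F) (fst z')" for z z'
          using r[OF F(1)] that by blast
        show "z = z'" if "z \<in> F'" "z' \<in> F'" "cut (r F) (fst z) = cut (r F) (fst z')" for z z'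
          using r[OF F(2)] that eq by simp
        fix z assume z: "z \<in> F'"
        then obtain z' where z': "z' \<in> F" "\<And>x. x \<in> underS k (r F) \<Longrightarrow> E z x = E z' x"
          using E[OF F(2,1) F(3)[symmetric]] eq by metis
        have "fst z' x = fst z x \<and> val z' x = val z x \<and> snd z' = snd z" if "x \<in> underS k (r F)" for x
        proof -
          have "x \<in> Field k" using that by (rule underS_Field)
          then have "(fst z x, val z x, snd z) = (fst z' x, val z' x, snd z')"
            using z'(2)[OF that] inj_onD[OF code(1)] in_code F z z'(1) unfolding E_def by blast
          then show ?thesis by simp
        qed
        then show "\<exists>z' \<in> F. \<forall>x \<in> underS k (r F). fst z' x = fst z x \<and> val z' x = val z x \<and> snd z' = snd z"
          using z'(1) by blast
      qed
    qed
  qed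
qed

text \<open>If \<open>i\<close> has no promise yet, let \<open>c\<close> lie above coordinates at
  which \<open>i\<close> differs from each branch in \<open>F\<close>. From level \<open>c\<close>
  on the new promise shares no node with an old one, so it cannot complete a forbidden
  triple.\<close>

lemma conds_extend:
  assumes F: "F \<in> conds" and i: "i \<in> I"
  shows "\<exists>u \<in> {i} \<times> Field k. insert u F \<in> conds"
proof (cases "\<exists>c. (i, c) \<in> F")
  case True
  then obtain c where c: "(i, c) \<in> F" by blast
  then have "c \<in> Field k" "insert (i, c) F = F" using F unfolding conds_def by auto
  then show ?thesis using F by (intro bexI[of _ "(i, c)"]) simp_all
next
  case False
  have F': "F \<subseteq> I \<times> Field k" "|F| <o k" using F unfolding conds_def by blast+
  have "\<exists>\<delta> \<in> Field k. i \<delta> \<noteq> fst v \<delta>" if "v \<in> F" for v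
  proof (rule fst_separated[OF i])
    show "fst v \<in> I" using that F'(1) by auto
    show "i \<noteq> fst v" using that False by (metis prod.collapse)
  qed
  then obtain \<delta> where \<delta>: "\<And>v. v \<in> F \<Longrightarrow> \<delta> v \<in> Field k \<and> i (\<delta> v) \<noteq> fst v (\<delta> v)" by metis
  have "|\<delta> ` F| <o k" using card_of_image F'(2) by (rule ordLeq_ordLess_trans)
  then obtain c where c: "c \<in> Field k" "\<delta> ` F \<subseteq> underS k c"
    using small_bounded[of "\<delta> ` F"] \<delta> by blast
  let ?u = "(i, c)"
  have new: "cut \<beta> i \<noteq> cut \<beta> (fst v)" if "v \<in> F" "(c, \<beta>) \<in> k" for v \<beta>
    using \<delta>[OF that(1)] c(2) that underS_le_trans unfolding cut_eq_iff by blast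
  have "\<not> bad x y z" if xyz: "x \<in> insert ?u F" "y \<in> insert ?u F" "z \<in> insert ?u F" for x y z
  proof
    assume "bad x y z"
    then consider "fst x = fst y" "x \<noteq> y" | "overfull x y z" unfolding bad_def by blast
    then show False
    proof cases
      case 1
      then show False using xyz False conds_inj[OF F] by (metis fst_conv insertE prod.collapse)
    next
      case 2
      then obtain \<beta> where act: "(snd x, \<beta>) \<in> k" "(snd y, \<beta>) \<in> k" "(snd z, \<beta>) \<in> k"
        and cut: "cut \<beta> (fst x) = cut \<beta> (fst y)" "cut \<beta> (fst y) = cut \<beta> (fst z)"
        and val: "val x \<beta> \<noteq> val y \<beta>" "val y \<beta> \<noteq> val z \<beta>" "val x \<beta> \<noteq> val z \<beta>"
        unfolding overfull_def by blast
      show False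
      proof (cases "x \<in> F \<and> y \<in> F \<and> z \<in> F")
        case True
        then show False using \<open>bad x y z\<close> F unfolding conds_def by blast
      next
        case False
        \<comment> \<open>One of the three is the new promise, so \<open>c \<le> \<beta>\<close>. As
          \<open>x\<close> and \<open>y\<close> have different values, at least one of them is old,
          and it would share a node of level \<open>\<beta>\<close> with the new promise.\<close>
        then have "(c, \<beta>) \<in> k" and "x \<in> F \<or> y \<in> F"
          using xyz act val by auto
        then show False using new[of _ \<beta>] xyz cut val False by (metis fst_conv insertE)
      qed
    qed
  qed
  then have "insert ?u F \<in> conds"
    using F' i c(1) small_insert unfolding conds_def by auto
  then show ?thesis using c(1) by blast
qed

text \<open>The axiom applied to \<open>conds\<close> with one dense set for each
  \<open>i \<in> I\<close>, asking that \<open>i\<close> receive a starting level.\<close>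

lemma ex_saturated:
  assumes GMA: "GMA TYPE('p) k"
    and universe: "ctwo ^c k \<le>o |UNIV :: 'p set|"
    and small: "|I| <o ctwo ^c k"
  shows "\<exists>G \<subseteq> I \<times> Field k. (\<forall>u \<in> G. \<forall>v \<in> G. \<forall>w \<in> G. \<not> overfull u v w) \<and>
    (\<forall>i \<in> I. \<exists>c. (i, c) \<in> G)"
proof -
  have C: "Cinfinite (ctwo ^c k)"
    using Cinfinite_cexp[OF ordLeq_refl[OF Card_order_ctwo] Cinf] .
  have "|Field k| \<le>o ctwo ^c k"
    using ordIso_ordLeq_trans[OF card_of_Field_ordIso[OF card]]
      ordLess_imp_ordLeq[OF ordLess_ctwo_cexp[OF card]] by blast
  then have size: "|I \<times> Field k| \<le>o ctwo ^c k"
    using C ordLess_imp_ordLeq[OF small] unfolding cinfinite_def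
    by (intro card_of_Times_ordLeq_infinite_Field) blast+
  obtain col where col: "\<And>F. F \<in> conds \<Longrightarrow> col F \<in> Field k"
    and linked: "\<And>F F' u v w. \<lbrakk>F \<in> conds; F' \<in> conds; col F = col F';
      u \<in> F \<union> F'; v \<in> F \<union> F'; w \<in> F \<union> F'\<rbrakk> \<Longrightarrow> \<not> bad u v w"
    using conds_colouring by blast
  have "\<exists>G \<subseteq> I \<times> Field k. (\<forall>u \<in> G. \<forall>v \<in> G. \<forall>w \<in> G. \<not> bad u v w) \<and>
      (\<forall>i \<in> I. ({i} \<times> Field k) \<inter> G \<noteq> {})"
    by (rule GMA_triples[where bad = bad and E = "\<lambda>i. {i} \<times> Field k", OF GMA universe size,
          folded conds_def, OF col linked conds_extend small])
  then obtain G where G: "G \<subseteq> I \<times> Field k" "\<forall>u \<in> G. \<forall>v \<in> G. \<forall>w \<in> G. \<not> bad u v w"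
    "\<forall>i \<in> I. ({i} \<times> Field k) \<inter> G \<noteq> {}"
    by (elim exE conjE)
  show ?thesis
  proof (intro exI[of _ G] conjI ballI)
    show "\<not> overfull u v w" if "u \<in> G" "v \<in> G" "w \<in> G" for u v w
      using G(2) that unfolding bad_def by blast
    show "\<exists>c. (i, c) \<in> G" if "i \<in> I" for i using G(3) that by blast
  qed (rule G(1))
qed

end

text \<open>Turns the ban on three different sequences at a node into a choice of two sequences, one
  for each slot.\<close>

lemma subset_pair:
  assumes "\<And>x y z. \<lbrakk>x \<in> T; y \<in> T; z \<in> T\<rbrakk> \<Longrightarrow> x = y \<or> y = z \<or> x = z"
  shows "\<exists>a b. T \<subseteq> {a, b}"
proof (cases "\<exists>x \<in> T. \<exists>y \<in> T. x \<noteq> y")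
  case True
  then obtain x y where "x \<in> T" "y \<in> T" "x \<noteq> y" by blast
  then have "T \<subseteq> {x, y}" using assms by blast
  then show ?thesis by blast
next
  case False
  then show ?thesis by blast
qed

subsection \<open>Additivity\<close>

context power_card
begin

text \<open>Each node gets two slots in \<open>X\<close>, and each \<open>A i\<close> is first
  covered by cones at the larger slots of nodes along \<open>i\<close>. The set \<open>G\<close>
  leaves at most two such cones per node, which are widened to the lengths of the two slots.\<close>

lemma strong_measure_zero_UN:
  fixes I :: "('k \<Rightarrow> bool) set"
  assumes GMA: "GMA TYPE('p) k"
    and universe: "ctwo ^c k \<le>o |UNIV :: 'p set|"
    and index: "I \<subseteq> space2 k" "|I| <o ctwo ^c k"
    and smz: "\<And>i. i \<in> I \<Longrightarrow> strong_measure_zero k (A i)"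
  shows "strong_measure_zero k (\<Union>i \<in> I. A i)"
  unfolding strong_measure_zero_def
proof (intro conjI allI impI)
  show "(\<Union>i \<in> I. A i) \<subseteq> space2 k" using smz unfolding strong_measure_zero_def by blast
  fix X assume "X \<subseteq> Field k \<and> |X| =o k"
  then have X: "X \<subseteq> Field k" "|X| =o k" by simp_all
  have "|nodes \<times> (UNIV :: bool set)| \<le>o k" by (rule card_Times[OF card_nodes card_bool])
  then obtain \<sigma> where \<sigma>: "inj_on \<sigma> (nodes \<times> (UNIV :: bool set))" "\<sigma> ` (nodes \<times> UNIV) \<subseteq> X"
    using inj_into X(2) by metis
  \<comment> \<open>The larger of the two slots: a sequence of this length can be cut down to either
    slot, and cutting only enlarges its cone.\<close>
  define m where "m n = (if (\<sigma> (n, False), \<sigma> (n, True)) \<in> k then \<sigma> (n, True) else \<sigma> (n, False))" for n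
  have \<sigma>X: "\<sigma> (n, b) \<in> X" if "n \<in> nodes" for n b using \<sigma>(2) that by blast
  have mX: "m n \<in> X" if "n \<in> nodes" for n using \<sigma>X[OF that] unfolding m_def by simp
  have \<sigma>m: "(\<sigma> (n, b), m n) \<in> k" if "n \<in> nodes" for n b
  proof -
    have "\<sigma> (n, False) \<in> Field k" "\<sigma> (n, True) \<in> Field k" using \<sigma>X[OF that] X(1) by blast+
    then show ?thesis
      using wo_rel.TOTALS[OF wo] unfolding m_def by (cases b) auto
  qed
  have m_eq: "n = n'" if "n \<in> nodes" "n' \<in> nodes" "m n = m n'" for n n'
  proof -
    obtain d d' where "m n = \<sigma> (n, d)" "m n' = \<sigma> (n', d')" unfolding m_def by metis
    then have "(n, d) = (n', d')" using that by (intro inj_onD[OF \<sigma>(1)]) simp_all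
    then show ?thesis by simp
  qed
  define node where "node i \<beta> = (\<beta>, cut \<beta> i)" for i \<beta>
  have node: "node i \<beta> \<in> nodes" if "\<beta> \<in> Field k" for i \<beta>
    using that cut_in_seqs2 unfolding node_def nodes_def by simp
  \<comment> \<open>The lengths served by a promise. By \<open>m_eq\<close> distinct levels give
    distinct lengths, so \<open>S u\<close> has size \<open>k\<close> and the strong measure zero of
    \<open>A (fst u)\<close> applies to it.\<close>
  define S where "S u = (\<lambda>\<beta>. m (node (fst u) \<beta>)) ` {\<beta> \<in> Field k. (snd u, \<beta>) \<in> k}" for u
  have "\<exists>f. (\<forall>\<xi> \<in> S u. f \<xi> \<in> seqs2 k \<xi>) \<and> A (fst u) \<subseteq> (\<Union>\<xi> \<in> S u. cone k \<xi> (f \<xi>))"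
    if u: "u \<in> I \<times> Field k" for u
  proof -
    have "inj_on (\<lambda>\<beta>. m (node (fst u) \<beta>)) {\<beta> \<in> Field k. (snd u, \<beta>) \<in> k}"
    proof (rule inj_onI)
      fix \<beta> \<beta>' assume "\<beta> \<in> {\<beta> \<in> Field k. (snd u, \<beta>) \<in> k}" "\<beta>' \<in> {\<beta> \<in> Field k. (snd u, \<beta>) \<in> k}"
        and "m (node (fst u) \<beta>) = m (node (fst u) \<beta>')"
      then have "node (fst u) \<beta> = node (fst u) \<beta>'" using m_eq node by blast
      then show "\<beta> = \<beta>'" unfolding node_def by simp
    qed
    then have "bij_betw (\<lambda>\<beta>. m (node (fst u) \<beta>)) {\<beta> \<in> Field k. (snd u, \<beta>) \<in> k} (S u)"
      unfolding S_def by (rule inj_on_imp_bij_betw)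
    then have "|S u| =o |{\<beta> \<in> Field k. (snd u, \<beta>) \<in> k}|"
      using card_of_ordIsoI ordIso_symmetric by blast
    moreover have "snd u \<in> Field k" using u by auto
    ultimately have "|S u| =o k" using card_tail ordIso_transitive by blast
    moreover have "S u \<subseteq> Field k" using mX node X(1) unfolding S_def by blast
    moreover have "fst u \<in> I" using u by auto
    ultimately show ?thesis using smz unfolding strong_measure_zero_def by blast
  qed
  then obtain f where cover: "\<And>u. u \<in> I \<times> Field k \<Longrightarrow>
      (\<forall>\<xi> \<in> S u. f u \<xi> \<in> seqs2 k \<xi>) \<and> A (fst u) \<subseteq> (\<Union>\<xi> \<in> S u. cone k \<xi> (f u \<xi>))"
    by metis
  interpret promises k I m f
  proof
    show "I \<subseteq> space2 k" by (rule index(1))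
    show "m n \<in> Field k" if "n \<in> nodes" for n using mX[OF that] X(1) by blast
    fix u \<beta> assume u: "u \<in> I \<times> Field k" "(snd u, \<beta>) \<in> k"
    then have "\<beta> \<in> Field k" unfolding Field_def by blast
    then have "m (node (fst u) \<beta>) \<in> S u" using u(2) unfolding S_def by blast
    then show "f u (m (\<beta>, cut \<beta> (fst u))) \<in> seqs2 k (m (\<beta>, cut \<beta> (fst u)))"
      using cover[OF u(1)] unfolding node_def by blast
  qed
  obtain G where G: "G \<subseteq> I \<times> Field k" "\<forall>u \<in> G. \<forall>v \<in> G. \<forall>w \<in> G. \<not> overfull u v w"
    "\<forall>i \<in> I. \<exists>c. (i, c) \<in> G"
    using ex_saturated[OF GMA universe index(2)] by (elim exE conjE)
  \<comment> \<open>The sequences that promises in \<open>G\<close> demand at the node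
    \<open>n\<close>.\<close>
  define T where "T n = {f u (m n) | u. u \<in> G \<and> (snd u, fst n) \<in> k \<and> cut (fst n) (fst u) = snd n}" for n
  have "\<exists>a b. T n \<subseteq> {a, b}" for n
  proof (rule subset_pair)
    fix x y z assume "x \<in> T n" "y \<in> T n" "z \<in> T n"
    then obtain u v w where uvw: "u \<in> G" "v \<in> G" "w \<in> G"
      and xyz: "x = f u (m n)" "y = f v (m n)" "z = f w (m n)"
      and act: "(snd u, fst n) \<in> k" "(snd v, fst n) \<in> k" "(snd w, fst n) \<in> k"
      and cut: "cut (fst n) (fst u) = snd n" "cut (fst n) (fst v) = snd n" "cut (fst n) (fst w) = snd n"
      unfolding T_def by blast
    have val: "val u (fst n) = (m n, x)" "val v (fst n) = (m n, y)" "val w (fst n) = (m n, z)"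
      using xyz act cut unfolding val_def by (simp_all add: Let_def)
    have "\<not> overfull u v w" using G(2) uvw by blast
    then have "\<not> (val u (fst n) \<noteq> val v (fst n) \<and> val v (fst n) \<noteq> val w (fst n) \<and>
        val u (fst n) \<noteq> val w (fst n))"
      using act cut unfolding overfull_def by simp
    then show "x = y \<or> y = z \<or> x = z" unfolding val by simp
  qed
  then obtain a b where ab: "\<And>n. T n \<subseteq> {a n, b n}" by metis
  define e where "e \<xi> = inv_into (nodes \<times> (UNIV :: bool set)) \<sigma> \<xi>" for \<xi>
  have e: "e (\<sigma> (n, c)) = (n, c)" if "n \<in> nodes" for n c
    using that \<sigma>(1) unfolding e_def by simp
  \<comment> \<open>The slot with bit \<open>False\<close> receives \<open>a\<close>, the one with
    bit \<open>True\<close> receives \<open>b\<close>. At an element of \<open>X\<close> that is no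
    slot the sequence is arbitrary, but \<open>cut\<close> still gives it the right length.\<close>
  define g where "g \<xi> = cut \<xi> ((if snd (e \<xi>) then b else a) (fst (e \<xi>)))" for \<xi>
  show "\<exists>g. (\<forall>\<xi> \<in> X. g \<xi> \<in> seqs2 k \<xi>) \<and> (\<Union>i \<in> I. A i) \<subseteq> (\<Union>\<xi> \<in> X. cone k \<xi> (g \<xi>))"
  proof (intro exI[of _ g] conjI ballI UN_least subsetI)
    show "g \<xi> \<in> seqs2 k \<xi>" for \<xi> unfolding g_def by (rule cut_in_seqs2)
    fix i \<eta> assume i: "i \<in> I" and \<eta>: "\<eta> \<in> A i"
    obtain c where c: "(i, c) \<in> G" using G(3) i by blast
    then have "(i, c) \<in> I \<times> Field k" using G(1) by blast
    then obtain \<zeta> where \<zeta>: "\<zeta> \<in> S (i, c)" "\<eta> \<in> cone k \<zeta> (f (i, c) \<zeta>)"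
      using cover[of "(i, c)"] \<eta> by auto
    then obtain \<beta> where \<beta>: "\<beta> \<in> Field k" "(c, \<beta>) \<in> k" "\<zeta> = m (node i \<beta>)"
      unfolding S_def by auto
    let ?n = "node i \<beta>"
    have n: "?n \<in> nodes" using node \<beta>(1) .
    have "f (i, c) \<zeta> \<in> T ?n"
      using c \<beta> unfolding T_def node_def by force
    then have "f (i, c) \<zeta> = a ?n \<or> f (i, c) \<zeta> = b ?n" using ab[of ?n] by blast
    define d where "d \<longleftrightarrow> f (i, c) \<zeta> = b ?n"
    have d: "f (i, c) \<zeta> = (if d then b else a) ?n"
      using \<open>_ \<or> _\<close> unfolding d_def by auto
    let ?\<xi> = "\<sigma> (?n, d)"
    have "g ?\<xi> = cut ?\<xi> (f (i, c) \<zeta>)" unfolding g_def e[OF n] using d by simp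
    \<comment> \<open>The slot is at most \<open>\<zeta>\<close>, so agreement of
      \<open>\<eta>\<close> with the sequence below \<open>\<zeta>\<close> passes to the
      slot.\<close>
    moreover have "underS k ?\<xi> \<subseteq> underS k \<zeta>" using \<sigma>m[OF n] \<beta>(3) underS_le_trans by blast
    ultimately have "\<eta> \<in> cone k ?\<xi> (g ?\<xi>)"
      using \<zeta>(2) unfolding cone_def cut_def by auto
    then show "\<eta> \<in> (\<Union>\<xi> \<in> X. cone k \<xi> (g \<xi>))" using \<sigma>X[OF n] by blast
  qed
qed

end

section \<open>Sequences indexed by the ordinals below \<open>\<gamma>\<close>\<close>

theorem theorem2p7:
  fixes k :: "'k rel"
    and \<gamma> :: "'k \<Rightarrow> bool"
    and A :: "('k \<Rightarrow> bool) \<Rightarrow> ('k \<Rightarrow> bool) set"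
  assumes card: "Card_order k"
    and uncountable: "natLeq <o k"
    and power: "eq_lt_power k"
    and universe: "ctwo ^c k \<le>o |UNIV :: 'p set|"
    and GMA: "GMA TYPE('p) k"
    and length: "\<gamma> \<in> Field (ctwo ^c k)"
    and smz: "\<forall>\<xi> \<in> underS (ctwo ^c k) \<gamma>. strong_measure_zero k (A \<xi>)"
  shows "strong_measure_zero k (\<Union>\<xi> \<in> underS (ctwo ^c k) \<gamma>. A \<xi>)"
proof -
  have "cinfinite k"
    using cinfinite_mono[OF ordLess_imp_ordLeq[OF uncountable] natLeq_cinfinite] .
  then interpret power_card k
    using card power by unfold_locales (auto simp: cinfinite_def)
  show ?thesis
  proof (rule strong_measure_zero_UN[OF GMA universe])
    \<comment> \<open>In this representation of \<open>2^k\<close> the ordinals are themselves the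
      branches, so the predecessors of \<open>\<gamma>\<close> can serve directly as the index set
      \<open>I\<close>.\<close>
    have "Field (ctwo ^c k) = space2 k"
      by (simp add: cexp_def ctwo_def space2_def Field_card_of)
    then show "underS (ctwo ^c k) \<gamma> \<subseteq> space2 k"
      using underS_Field[of _ "ctwo ^c k" \<gamma>] by auto
    show "|underS (ctwo ^c k) \<gamma>| <o ctwo ^c k"
      by (rule card_of_underS[OF Card_order_cexp length])
    show "strong_measure_zero k (A i)" if "i \<in> underS (ctwo ^c k) \<gamma>" for i
      using smz that by blast
  qed
qed

end
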